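(* Let $V\in L^\infty_{\rm loc}(\mathbb{R}^d)$ be an a.e. non-negative potential. Suppose that the semigroup $e^{-tL}$ has exponential decay of some order $\delta>0$, i.e. there is $C>0$ with $\|e^{-tL}(\mathbf 1)\|_\infty\leqslant Ce^{-\delta t}$ for all $t>0$. If for some $a>0$ there are a compact set $F\subset\mathbb{R}^d$ and a constant $C'>0$ such that $I^a(V)(x)\leqslant C'$ for a.e. $x\notin F$, then the operator $R_V^a$ is bounded on $L^\infty(\mathbb{R}^d)$.
   Context: Let $L=-\frac12\Delta+V$. For $t>0$ and $f\in L^\infty$ (in particular for the constant function $\mathbf 1$) define $e^{-tL}f(x)=\mathbb{E}_x\big[e^{-\int_0^tV(X_s)\,ds}f(X_t)\big]$, where $\mathbb{E}_x$ is expectation for the standard $d$-dimensional Brownian motion $\{X_s\}$ (generator $\frac12\Delta$) started at $x$. For $a>0$ put $$R_V^a(\mathbf 1)(x)=V^a(x)\cdot\frac1{\Gamma(a)}\int_0^\infty e^{-tL}(\mathbf 1)(x)\,t^{a-1}\,dt\in[0,\infty].$$ $R_V^a$ is said to be bounded on $L^\infty$ if $\|R_V^a(\mathbf 1)\|_\infty<\infty$. $V(x)$ denotes the value at $x$ of a fixed representative of $V$, and $B(x,r)$ is the closed Euclidean ball. For $u\geqslant1$ put $$\rho_x(u)=\sup\{r\geqslant0:\ V(x)/u\leqslant V(y)\text{ for a.e. }y\in B(x,r)\}\in[0,\infty],$$ and for $a>0$ $$I^a(V)(x)=\int_1^{\max(1,V(x))}s^{a-1}e^{-\rho_x(s)^2/(4d)}\,ds,$$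 with $e^{-\rho_x(s)^2/(4d)}=0$ if $\rho_x(s)=\infty$. *)

theory Defs
  imports "HOL-Probability.Probability" "HOL-Probability.Essential_Supremum"
begin

text \<open>
  Euclidean space \<open>\<real>\<^sup>d\<close> is a type \<open>'a :: euclidean_space\<close> with \<open>d = DIM('a)\<close>.
  A standard Brownian motion is a process \<open>B\<close> started at the origin; the motion started
  at \<open>x\<close> is \<open>\<lambda>s \<omega>. x + B s \<omega>\<close>. The increment over \<open>[s, t]\<close> has covariance \<open>(t - s) I\<close>,
  which is the normalisation with generator one half of the Laplacian.
\<close>

locale brownian_motion = prob_space M
  for M :: "'w measure" +
  fixes B :: "real \<Rightarrow> 'w \<Rightarrow> 'a :: euclidean_space"
  assumes measurable_B: "\<And>t. 0 \<le> t \<Longrightarrow> B t \<in> borel_measurable M"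
    and start: "\<And>\<omega>. \<omega> \<in> space M \<Longrightarrow> B 0 \<omega> = 0"
    and continuous_paths: "\<And>\<omega>. \<omega> \<in> space M \<Longrightarrow> continuous_on {0..} (\<lambda>t. B t \<omega>)"
    and gaussian_increments: "\<And>s t. 0 \<le> s \<Longrightarrow> s < t \<Longrightarrow>
      distributed M lborel (\<lambda>\<omega>. B t \<omega> - B s \<omega>)
        (\<lambda>y. ennreal (\<Prod>b\<in>Basis. normal_density 0 (sqrt (t - s)) (y \<bullet> b)))"
    and independent_increments: "\<And>(t :: nat \<Rightarrow> real) n.
      0 \<le> t 0 \<Longrightarrow> (\<And>i. i < n \<Longrightarrow> t i < t (Suc i)) \<Longrightarrow>
      indep_vars (\<lambda>_. borel) (\<lambda>i \<omega>. B (t (Suc i)) \<omega> - B (t i) \<omega>) {..<n}"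

definition Linf_loc :: "('a :: euclidean_space \<Rightarrow> real) \<Rightarrow> bool" where
  "Linf_loc V \<longleftrightarrow> V \<in> borel_measurable lebesgue \<and>
     (\<forall>K. compact K \<longrightarrow> (\<exists>c. AE x in lebesgue. x \<in> K \<longrightarrow> \<bar>V x\<bar> \<le> c))"

text \<open>
  A Lebesgue measurable \<open>V\<close> need not be Borel. Almost surely the path functional below agrees
  with the one of a Borel modification of \<open>V\<close>, so it is measurable with respect to the
  completed measures, which are therefore the ones used for both integrals.
\<close>

definition schrodinger_semigroup ::
  "'w measure \<Rightarrow> (real \<Rightarrow> 'w \<Rightarrow> 'a) \<Rightarrow> ('a :: euclidean_space \<Rightarrow> real) \<Rightarrow>
    real \<Rightarrow> ('a \<Rightarrow> real) \<Rightarrow> 'a \<Rightarrow> real" where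
  "schrodinger_semigroup M B V t f x =
     (LINT \<omega>|completion M.
        exp (- (LINT s:{0..t}|lebesgue. V (x + B s \<omega>))) * f (x + B t \<omega>))"

definition Linf_norm :: "('a :: euclidean_space \<Rightarrow> real) \<Rightarrow> ennreal" where
  "Linf_norm f = esssup lebesgue (\<lambda>x. ennreal \<bar>f x\<bar>)"

definition exponential_decay ::
  "'w measure \<Rightarrow> (real \<Rightarrow> 'w \<Rightarrow> 'a) \<Rightarrow> ('a :: euclidean_space \<Rightarrow> real) \<Rightarrow> real \<Rightarrow> bool" where
  "exponential_decay M B V \<delta> \<longleftrightarrow>
     (\<exists>C>0. \<forall>t>0. Linf_norm (schrodinger_semigroup M B V t (\<lambda>_. 1)) \<le> ennreal (C * exp (- \<delta> * t)))"

definition riesz_one ::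
  "'w measure \<Rightarrow> (real \<Rightarrow> 'w \<Rightarrow> 'a) \<Rightarrow> ('a :: euclidean_space \<Rightarrow> real) \<Rightarrow> real \<Rightarrow> 'a \<Rightarrow> ennreal" where
  "riesz_one M B V a x =
     ennreal (V x powr a) * (ennreal (1 / Gamma a) *
       (\<integral>\<^sup>+t\<in>{0<..}. ennreal (schrodinger_semigroup M B V t (\<lambda>_. 1) x * t powr (a - 1)) \<partial>lborel))"

definition riesz_bounded ::
  "'w measure \<Rightarrow> (real \<Rightarrow> 'w \<Rightarrow> 'a) \<Rightarrow> ('a :: euclidean_space \<Rightarrow> real) \<Rightarrow> real \<Rightarrow> bool" where
  "riesz_bounded M B V a \<longleftrightarrow> esssup lebesgue (riesz_one M B V a) < \<infinity>"

definition rho :: "('a :: euclidean_space \<Rightarrow> real) \<Rightarrow> 'a \<Rightarrow> real \<Rightarrow> ereal" where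
  "rho V x u =
     (SUP r\<in>{r. 0 \<le> r \<and> (AE y in lebesgue. y \<in> cball x r \<longrightarrow> V x / u \<le> V y)}. ereal r)"

definition gauss_weight :: "('a :: euclidean_space \<Rightarrow> real) \<Rightarrow> 'a \<Rightarrow> real \<Rightarrow> real" where
  "gauss_weight V x s =
     (if rho V x s = \<infinity> then 0
      else exp (- (real_of_ereal (rho V x s))\<^sup>2 / (4 * real DIM('a))))"

definition I_fun :: "real \<Rightarrow> ('a :: euclidean_space \<Rightarrow> real) \<Rightarrow> 'a \<Rightarrow> real" where
  "I_fun a V x = (LINT s:{1..max 1 (V x)}|lborel. s powr (a - 1) * gauss_weight V x s)"

end

theory Submission
  imports Defs "HOL-Real_Asymp.Real_Asymp"
begin

text \<open>
  Let \<open>u t x = E (exp (- \<integral>\<^bsub>0\<^esub>\<^bsup>t\<^esup> V (x + B s) ds))\<close>, the probability that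
  Brownian motion started at \<open>x\<close> and killed at rate \<open>V\<close> survives up to time \<open>t\<close>. The integral of
  \<open>V x powr a * u t x * t powr (a - 1)\<close> over \<open>t > 0\<close> is estimated in two steps.

  Long times. By the Markov property at a fixed time \<open>h\<close> and the exponential decay,
  \<open>u t x \<le> D * exp (- \<delta> * (t - h)) * u h x\<close> for \<open>t > h\<close> (\<open>survival_Markov\<close>, \<open>survival_decay\<close>).
  As \<open>u\<close> decreases in time, the integral over all times is at most a constant times the integral over
  \<open>[0, h]\<close> (\<open>survival_integral_tail\<close>). This already settles all points where \<open>V\<close> is bounded, such as
  those of \<open>F\<close>.

  Short times. Suppose \<open>V x \<ge> 1\<close> and \<open>s \<ge> 1\<close>. As long as the path stays in the ball around \<open>x\<close> of radius
  \<open>rho V x s\<close>, it is killed at rate at least \<open>V x / s\<close>, so its contribution to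
  \<open>V x powr a * \<integral> \<dots> t powr (a - 1) dt\<close> is at most \<open>Gamma a * s powr a\<close>. A larger contribution requires
  leaving the ball before time \<open>h\<close>, which has probability at most a constant times
  \<open>exp (- (rho V x s)\<^sup>2 / (4 * d))\<close> if \<open>h\<close> is small (\<open>path_tail\<close>). Integrating the tail of the
  contribution over its levels \<open>s powr a\<close>, where \<open>1 \<le> s \<le> V x\<close>, produces exactly \<open>I_fun a V x\<close>
  (\<open>survival_integral_local\<close>).

  The freedom in the choice of \<open>h\<close> allows a crude maximal inequality: chaining over dyadic increments
  loses a constant in the exponent, and a short horizon regains it.

  The Markov property, for expectations of a function of the energy, follows from equality
  of two laws on a countable product space: that of Brownian motion sampled on a dyadic grid,
  and that of a path of Brownian motion continued after time \<open>h\<close> by an independent copy (\<open>law_restart\<close>).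
\<close>

section \<open>A Borel potential and the energy of a path\<close>

lemma AE_eq_borel_measurable_completion:
  fixes f g :: "'b \<Rightarrow> 'c :: topological_space"
  assumes g: "g \<in> borel_measurable M" and eq: "AE x in M. f x = g x"
  shows "f \<in> borel_measurable (completion M)"
proof (rule borel_measurableI)
  fix S :: "'c set" assume "open S"
  have A: "g -` S \<inter> space M \<in> sets (completion M)"
    using measurable_sets[OF g borel_open[OF \<open>open S\<close>]] by (rule sets_completionI_sets)
  have "AE x in completion M. x \<in> g -` S \<inter> space M \<longleftrightarrow> x \<in> f -` S \<inter> space M"
    using AE_completion[OF eq] by eventually_elim auto
  from completion.in_sets_AE[OF this A] show "f -` S \<inter> space (completion M) \<in> sets (completion M)"
    by simp
qed

lemma integral_completion_AE_eq:
  fixes f g :: "'b \<Rightarrow> 'c :: {banach, second_countable_topology}"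
  assumes g: "g \<in> borel_measurable M" and eq: "AE x in M. f x = g x"
  shows "(LINT x|completion M. f x) = (LINT x|M. g x)"
proof -
  have "(LINT x|completion M. f x) = (LINT x|completion M. g x)"
    using AE_eq_borel_measurable_completion[OF g eq] measurable_completion[OF g] AE_completion[OF eq]
    by (intro integral_cong_AE)
  then show ?thesis
    using g by (simp add: integral_completion)
qed

text \<open>
  The two bounds hold at every point, not only almost everywhere. A Brownian path has Lebesgue
  measure zero for \<open>d \<ge> 2\<close>, so almost everywhere bounds say nothing about a single path, whereas
  pointwise ones make the energy of every continuous path a finite integral.
\<close>

definition locally_bounded_potential :: "('a :: euclidean_space \<Rightarrow> real) \<Rightarrow> bool" where
  "locally_bounded_potential U \<longleftrightarrow>
     U \<in> borel_measurable borel \<and> (\<forall>x. 0 \<le> U x) \<and> (\<forall>K. compact K \<longrightarrow> (\<exists>c. \<forall>x\<in>K. U x \<le> c))"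

definition energy :: "('a :: euclidean_space \<Rightarrow> real) \<Rightarrow> real \<Rightarrow> 'a \<Rightarrow> (real \<Rightarrow> 'a) \<Rightarrow> real" where
  "energy U t x p = (LINT s:{0..t}|lborel. U (x + p s))"

lemma locally_bounded_potential_representative:
  fixes V :: "'a :: euclidean_space \<Rightarrow> real"
  assumes "Linf_loc V" and "AE x in lebesgue. 0 \<le> V x"
  obtains U where "locally_bounded_potential U" and "AE x in lborel. V x = U x"
proof -
  have "V \<in> borel_measurable lebesgue"
    using assms(1) by (simp add: Linf_loc_def)
  from completion_ex_borel_measurable_real[OF this]
  obtain V' where V': "V' \<in> borel_measurable lborel" and eq: "AE x in lborel. V x = V' x"
    by blast
  have "\<forall>n::nat. \<exists>c. AE x in lebesgue. x \<in> cball 0 (real n) \<longrightarrow> \<bar>V x\<bar> \<le> c"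
  proof
    fix n :: nat
    show "\<exists>c. AE x in lebesgue. x \<in> cball (0::'a) (real n) \<longrightarrow> \<bar>V x\<bar> \<le> c"
      using assms(1) compact_cball[of "0::'a" "real n"] unfolding Linf_loc_def by metis
  qed
  then obtain c where c: "\<And>n. AE x in lebesgue. x \<in> cball (0::'a) (real n) \<longrightarrow> \<bar>V x\<bar> \<le> c n"
    by metis
  have good: "AE x in lborel. V x = V' x \<and> 0 \<le> V x \<and> (\<forall>n. x \<in> cball 0 (real n) \<longrightarrow> \<bar>V x\<bar> \<le> c n)"
    using eq assms(2) c by (simp add: AE_completion_iff AE_all_countable)
  then obtain N where N: "N \<in> null_sets lborel"
    "{x \<in> space lborel. \<not> (V x = V' x \<and> 0 \<le> V x \<and> (\<forall>n. x \<in> cball 0 (real n) \<longrightarrow> \<bar>V x\<bar> \<le> c n))} \<subseteq> N"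
    unfolding eventually_ae_filter by blast
  then have [measurable]: "N \<in> sets borel" by auto
  have outside: "V x = V' x \<and> 0 \<le> V x \<and> (\<forall>n. x \<in> cball 0 (real n) \<longrightarrow> \<bar>V x\<bar> \<le> c n)" if "x \<notin> N" for x
  proof (rule ccontr)
    assume "\<not> ?thesis"
    then have "x \<in> N" by (intro subsetD[OF N(2)]) simp
    with that show False by blast
  qed
  define U where "U x = (if x \<in> N then 0 else V' x)" for x
  have "U \<in> borel_measurable borel"
    unfolding U_def using V' by measurable
  moreover have "0 \<le> U x" for x
    using outside[of x] by (auto simp: U_def)
  moreover have "\<exists>b. \<forall>x\<in>K. U x \<le> b" if "compact K" for K
  proof -
    obtain r where r: "\<forall>x\<in>K. norm x \<le> r"
      using compact_imp_bounded[OF \<open>compact K\<close>] by (auto simp: bounded_iff)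
    have "U x \<le> max 0 (c (nat \<lceil>r\<rceil>))" if "x \<in> K" for x
    proof (cases "x \<in> N")
      case False
      have "norm x \<le> real (nat \<lceil>r\<rceil>)"
        using r that by (meson order_trans real_nat_ceiling_ge)
      then show ?thesis
        using outside[OF False] by (force simp: U_def False)
    qed (simp add: U_def)
    then show ?thesis by blast
  qed
  ultimately have "locally_bounded_potential U"
    by (simp add: locally_bounded_potential_def)
  moreover have "AE x in lborel. V x = U x"
    using good AE_not_in[OF N(1)] by eventually_elim (simp add: U_def)
  ultimately show ?thesis by (rule that)
qed

lemma energy_integrable:
  fixes p :: "real \<Rightarrow> 'a :: euclidean_space"
  assumes U: "locally_bounded_potential U" and p: "continuous_on {0..} p"
  shows "set_integrable lborel {0..t} (\<lambda>s. U (x + p s))"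
proof -
  have [measurable]: "U \<in> borel_measurable borel"
    using U by (simp add: locally_bounded_potential_def)
  have K: "compact ((\<lambda>s. x + p s) ` {0..t})"
    by (intro compact_continuous_image continuous_intros continuous_on_subset[OF p]) auto
  then obtain c where c: "\<And>s. s \<in> {0..t} \<Longrightarrow> U (x + p s) \<le> c"
    using U K by (force simp: locally_bounded_potential_def)
  have "continuous_on UNIV (\<lambda>s. p (max 0 s))"
    by (intro continuous_on_compose2[OF p] continuous_intros) auto
  then have [measurable]: "(\<lambda>s. p (max 0 s)) \<in> borel_measurable borel"
    by (rule borel_measurable_continuous_onI)
  have "set_integrable lborel {0..t} (\<lambda>s. U (x + p (max 0 s)))"
    unfolding set_integrable_def
  proof (rule integrableI_bounded_set[where A="{0..t}" and B=c])
    show "AE s in lborel. s \<in> {0..t} \<longrightarrow> norm (indicator {0..t} s *\<^sub>R U (x + p (max 0 s))) \<le> c"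
      using U c by (auto simp: locally_bounded_potential_def)
  qed (auto simp: emeasure_lborel_Icc_eq)
  also have "?this \<longleftrightarrow> ?thesis"
    by (intro set_integrable_cong) auto
  finally show ?thesis .
qed

lemma energy_nonneg: "locally_bounded_potential U \<Longrightarrow> 0 \<le> energy U t x p"
  unfolding energy_def set_lebesgue_integral_def
  by (intro integral_nonneg_AE AE_I2) (simp add: locally_bounded_potential_def)

lemma energy_mono:
  assumes "locally_bounded_potential U" and "continuous_on {0..} p" and "t \<le> t'"
  shows "energy U t x p \<le> energy U t' x p"
  unfolding energy_def set_lebesgue_integral_def
proof (rule integral_mono)
  show "integrable lborel (\<lambda>s. indicator {0..t} s *\<^sub>R U (x + p s))"
    "integrable lborel (\<lambda>s. indicator {0..t'} s *\<^sub>R U (x + p s))"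
    using energy_integrable[OF assms(1,2)] by (auto simp: set_integrable_def)
  show "indicator {0..t} s *\<^sub>R U (x + p s) \<le> indicator {0..t'} s *\<^sub>R U (x + p s)" for s
    using assms by (auto simp: indicator_def locally_bounded_potential_def)
qed

text \<open>
  Additivity of the action over \<open>[0, h]\<close> and \<open>[h, t]\<close>, with the second piece written as the energy of
  the path restarted at time \<open>h\<close>: the deterministic half of the Markov property.
\<close>

lemma energy_split:
  assumes U: "locally_bounded_potential U" and p: "continuous_on {0..} p" and "0 \<le> h" "h \<le> t"
  shows "energy U t x p = energy U h x p + energy U (t - h) (x + p h) (\<lambda>s. p (h + s) - p h)"
proof -
  have int: "set_integrable lborel {0..t} (\<lambda>s. U (x + p s))"
    by (rule energy_integrable[OF U p])
  have un: "{0..t} = {0..h} \<union> {h<..t}" using assms by auto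
  have "energy U t x p = energy U h x p + (LINT s:{h<..t}|lborel. U (x + p s))"
    unfolding energy_def un
    by (rule set_integral_Un) (auto intro!: set_integrable_subset[OF int] simp: un)
  also have "(LINT s:{h<..t}|lborel. U (x + p s)) = (LINT s:{0<..t-h}|lborel. U (x + p (h + s)))"
    unfolding set_lebesgue_integral_def
    by (subst lborel_integral_real_affine[where c=1 and t=h])
      (auto intro!: Bochner_Integration.integral_cong simp: indicator_def)
  also have "\<dots> = (LINT s:{0..t-h}|lborel. U (x + p (h + s)))"
    by (rule set_integral_discrete_difference[where X="{0}"]) auto
  finally show ?thesis by (simp add: energy_def)
qed

lemma energy_ge:
  assumes U: "locally_bounded_potential U" and p: "continuous_on {0..} p" and "0 \<le> t"
    and ge: "AE s in lborel. s \<in> {0..t} \<longrightarrow> c \<le> U (x + p s)"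
  shows "t * c \<le> energy U t x p"
proof -
  have "t * c = (LINT s:{0..t}|lborel. c)"
    using \<open>0 \<le> t\<close> by (simp add: set_lebesgue_integral_def)
  also have "\<dots> \<le> energy U t x p"
    unfolding energy_def set_lebesgue_integral_def
  proof (rule integral_mono_AE)
    show "integrable lborel (\<lambda>s. indicator {0..t} s *\<^sub>R c)"
      by (intro integrable_scaleR_left integrable_real_indicator) (auto simp: emeasure_lborel_Icc_eq)
    show "integrable lborel (\<lambda>s. indicator {0..t} s *\<^sub>R U (x + p s))"
      using energy_integrable[OF U p, of t x] by (simp add: set_integrable_def)
    show "AE s in lborel. indicator {0..t} s *\<^sub>R c \<le> indicator {0..t} s *\<^sub>R U (x + p s)"
      using ge by eventually_elim (auto simp: indicator_def)
  qed
  finally show ?thesis .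
qed

section \<open>Recovering a continuous path from a dyadic grid\<close>

text \<open>
  The energy depends on the whole path, but a continuous path is determined by its values on the
  countable set \<open>grid h\<close>. The energy of \<open>skeleton_path h f\<close> is a measurable function of \<open>f\<close> in the
  countable product space, and it is the energy of \<open>p\<close> when \<open>f\<close> samples a continuous \<open>p\<close>.
  This reduces expectations of energies to laws on a product space; it also yields all the joint
  measurability that Fubini's theorem requires.
\<close>

definition grid :: "real \<Rightarrow> real set" where
  "grid h = {h * real j / 2 ^ n | j n. True}"

definition grid_time :: "real \<Rightarrow> nat \<Rightarrow> real \<Rightarrow> real" where
  "grid_time h n s = h * real (nat \<lfloor>s * 2 ^ n / h\<rfloor>) / 2 ^ n"

definition skeleton_path :: "real \<Rightarrow> (real \<Rightarrow> 'a :: euclidean_space) \<Rightarrow> real \<Rightarrow> 'a" where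
  "skeleton_path h f s = lim (\<lambda>n. f (grid_time h n s))"

lemma grid_time_in_grid: "grid_time h n s \<in> grid h"
  by (auto simp: grid_def grid_time_def)

lemma grid_nonneg: "0 < h \<Longrightarrow> d \<in> grid h \<Longrightarrow> 0 \<le> d"
  by (auto simp: grid_def)

lemma grid_time_tendsto:
  assumes "0 < h"
  shows "(\<lambda>n. grid_time h n s) \<longlonglongrightarrow> max 0 s"
proof (cases "0 \<le> s")
  case True
  have "\<bar>grid_time h n s - s\<bar> \<le> h * (1 / 2) ^ n" for n
  proof -
    have "0 \<le> s * 2 ^ n / h" using assms True by simp
    then have nat: "real (nat \<lfloor>s * 2 ^ n / h\<rfloor>) = of_int \<lfloor>s * 2 ^ n / h\<rfloor>"
      by simp
    have "grid_time h n s = h / 2 ^ n * of_int \<lfloor>s * 2 ^ n / h\<rfloor>"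
      unfolding grid_time_def nat by simp
    moreover have "s = h / 2 ^ n * (s * 2 ^ n / h)" using assms by simp
    ultimately have "grid_time h n s - s = h / 2 ^ n * (of_int \<lfloor>s * 2 ^ n / h\<rfloor> - s * 2 ^ n / h)"
      by (metis right_diff_distrib)
    then have "\<bar>grid_time h n s - s\<bar> = h / 2 ^ n * \<bar>of_int \<lfloor>s * 2 ^ n / h\<rfloor> - s * 2 ^ n / h\<bar>"
      using assms by (simp add: abs_mult)
    also have "\<dots> \<le> h / 2 ^ n * 1"
      using assms by (intro mult_left_mono) (linarith, simp)
    finally show ?thesis by (simp add: power_one_over)
  qed
  then have "\<forall>\<^sub>F n in sequentially. norm (grid_time h n s - s) \<le> h * (1 / 2) ^ n"
    by simp
  moreover have "(\<lambda>n. h * (1 / 2) ^ n) \<longlonglongrightarrow> 0"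
    by (rule tendsto_mult_right_zero[OF LIMSEQ_power_zero]) simp
  ultimately have "(\<lambda>n. grid_time h n s - s) \<longlonglongrightarrow> 0"
    by (rule Lim_null_comparison)
  then show ?thesis
    using True by (simp add: LIM_zero_iff)
next
  case False
  have "nat \<lfloor>s * 2 ^ n / h\<rfloor> = 0" for n
  proof -
    have "s * 2 ^ n / h < 0" using False assms by (simp add: divide_neg_pos mult_neg_pos)
    then show ?thesis by simp
  qed
  then have "grid_time h n s = 0" for n
    by (simp add: grid_time_def)
  then show ?thesis using False by simp
qed

lemma skeleton_path_eq:
  assumes "0 < h" "continuous_on {0..} p"
  shows "skeleton_path h (restrict p (grid h)) s = p (max 0 s)"
proof -
  have "(\<lambda>n. p (grid_time h n s)) \<longlonglongrightarrow> p (max 0 s)"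
    by (rule continuous_on_tendsto_compose[OF assms(2) grid_time_tendsto[OF assms(1)]])
      (auto intro!: always_eventually grid_nonneg[OF assms(1) grid_time_in_grid])
  then show ?thesis
    unfolding skeleton_path_def by (intro limI) (simp add: grid_time_in_grid)
qed

text \<open>
  For fixed \<open>n\<close> the sampling time takes countably many values, each of which selects one coordinate;
  a limit of measurable functions is measurable.
\<close>

lemma measurable_skeleton_path:
  assumes X[measurable]: "X \<in> M \<rightarrow>\<^sub>M PiM (grid h) (\<lambda>_. borel)" and s[measurable]: "s \<in> borel_measurable M"
  shows "(\<lambda>z. skeleton_path h (X z) (s z)) \<in> borel_measurable M"
  unfolding skeleton_path_def
proof (rule borel_measurable_lim_metric)
  fix n
  have "(\<lambda>z. X z (h * real j / 2 ^ n)) \<in> borel_measurable M" for j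
    by (rule measurable_compose[OF X measurable_component_singleton]) (auto simp: grid_def)
  moreover have "(\<lambda>z. nat \<lfloor>s z * 2 ^ n / h\<rfloor>) \<in> M \<rightarrow>\<^sub>M count_space UNIV"
    by measurable
  ultimately show "(\<lambda>z. X z (grid_time h n (s z))) \<in> borel_measurable M"
    unfolding grid_time_def by (rule measurable_compose_countable)
qed

lemma measurable_energy_skeleton_path:
  assumes U[measurable]: "U \<in> borel_measurable borel"
    and X[measurable]: "X \<in> M \<rightarrow>\<^sub>M PiM (grid h) (\<lambda>_. borel)"
    and [measurable]: "t \<in> borel_measurable M" "x \<in> borel_measurable M"
  shows "(\<lambda>z. energy U (t z) (x z) (skeleton_path h (X z))) \<in> borel_measurable M"
proof -
  have [measurable]: "(\<lambda>w. skeleton_path h (X (fst w)) (snd w)) \<in> borel_measurable (M \<Otimes>\<^sub>M lborel)"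
    by (rule measurable_skeleton_path) measurable
  have "energy U (t z) (x z) (skeleton_path h (X z)) =
      (LINT s|lborel. (if 0 \<le> s \<and> s \<le> t z then U (x z + skeleton_path h (X z) s) else 0))" for z
    unfolding energy_def set_lebesgue_integral_def
    by (intro Bochner_Integration.integral_cong) (auto simp: indicator_def)
  moreover have "(\<lambda>z. LINT s|lborel. (if 0 \<le> s \<and> s \<le> t z then U (x z + skeleton_path h (X z) s) else 0))
      \<in> borel_measurable M"
  proof (rule sigma_finite_measure.borel_measurable_lebesgue_integral[OF sigma_finite_lborel])
    show "(\<lambda>(z, s). if 0 \<le> s \<and> s \<le> t z then U (x z + skeleton_path h (X z) s) else 0)
        \<in> borel_measurable (M \<Otimes>\<^sub>M lborel)"
      unfolding split_beta by measurable
  qed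
  ultimately show ?thesis by simp
qed

lemma energy_cong:
  "(\<And>s. 0 \<le> s \<Longrightarrow> s \<le> t \<Longrightarrow> U (x + p s) = U' (x' + p' s)) \<Longrightarrow> energy U t x p = energy U' t x' p'"
  unfolding energy_def by (rule set_lebesgue_integral_cong) auto

lemma grid_common_level:
  assumes "finite J" "J \<subseteq> grid h"
  shows "\<exists>n N k. \<forall>d\<in>J. k d \<le> N \<and> d = h * real (k d) / 2 ^ n"
proof -
  have "\<exists>n. \<forall>d\<in>J. \<exists>k. d = h * real k / 2 ^ n"
    using assms
  proof (induction J)
    case (insert d J)
    then obtain n where n: "\<forall>d\<in>J. \<exists>k. d = h * real k / 2 ^ n" by auto
    obtain j m where d: "d = h * real j / 2 ^ m" using insert by (auto simp: grid_def)
    have raise: "\<exists>k'. h * real k / 2 ^ i = h * real k' / 2 ^ (i + l)" for k i l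
      by (intro exI[of _ "k * 2 ^ l"]) (simp add: power_add)
    have "\<exists>k. d = h * real k / 2 ^ (n + m)"
      using raise[of j m n] d by (simp add: add.commute)
    moreover have "\<exists>k. d' = h * real k / 2 ^ (n + m)" if "d' \<in> J" for d'
      using raise[of _ n m] n that by metis
    ultimately show ?case by blast
  qed simp
  then obtain n where "\<forall>d\<in>J. \<exists>k. d = h * real k / 2 ^ n" by blast
  then obtain k where k: "\<forall>d\<in>J. d = h * real (k d) / 2 ^ n" by metis
  have "k d \<le> Max (k ` J)" if "d \<in> J" for d
    using that assms by simp
  with k show ?thesis by blast
qed

text \<open>
  The law of a process on the grid is determined by its cylinder sets. Finitely many grid
  times are multiples of one mesh \<open>h / 2 ^ n\<close>, and for a process started at \<open>0\<close> the values at
  these times are partial sums of the increments over that mesh. Hence it is enough to compare the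
  joint laws of consecutive increments on each mesh, and those are determined by rectangles.
\<close>

lemma grid_law_eqI:
  fixes P :: "real \<Rightarrow> 'w \<Rightarrow> 'a :: euclidean_space" and Q :: "real \<Rightarrow> 'v \<Rightarrow> 'a"
  assumes M1: "prob_space M1" and M2: "prob_space M2"
    and P: "\<And>d. d \<in> grid h \<Longrightarrow> P d \<in> borel_measurable M1" "\<And>w. w \<in> space M1 \<Longrightarrow> P 0 w = 0"
    and Q: "\<And>d. d \<in> grid h \<Longrightarrow> Q d \<in> borel_measurable M2" "\<And>w. w \<in> space M2 \<Longrightarrow> Q 0 w = 0"
    and eq: "\<And>n N A. (\<And>i::nat. A i \<in> sets borel) \<Longrightarrow>
      emeasure M1 {w \<in> space M1. \<forall>i<N. P (h * real (Suc i) / 2 ^ n) w - P (h * real i / 2 ^ n) w \<in> A i} =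
      emeasure M2 {w \<in> space M2. \<forall>i<N. Q (h * real (Suc i) / 2 ^ n) w - Q (h * real i / 2 ^ n) w \<in> A i}"
  shows "distr M1 (PiM (grid h) (\<lambda>_. borel)) (\<lambda>w. restrict (\<lambda>d. P d w) (grid h)) =
    distr M2 (PiM (grid h) (\<lambda>_. borel)) (\<lambda>w. restrict (\<lambda>d. Q d w) (grid h))"
proof (rule measure_eqI_PiM_infinite)
  have mP: "(\<lambda>w. restrict (\<lambda>d. P d w) (grid h)) \<in> M1 \<rightarrow>\<^sub>M PiM (grid h) (\<lambda>_. borel)"
    and mQ: "(\<lambda>w. restrict (\<lambda>d. Q d w) (grid h)) \<in> M2 \<rightarrow>\<^sub>M PiM (grid h) (\<lambda>_. borel)"
    by (intro measurable_restrict P(1) Q(1); assumption)+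
  show "finite_measure (distr M1 (PiM (grid h) (\<lambda>_. borel)) (\<lambda>w. restrict (\<lambda>d. P d w) (grid h)))"
    using prob_space.prob_space_distr[OF M1 mP] by (simp add: prob_space_def)
  fix A :: "real \<Rightarrow> 'a set" and J assume J: "finite J" "J \<subseteq> grid h" and A: "\<And>i. i \<in> J \<Longrightarrow> A i \<in> sets borel"
  obtain n N k where "\<forall>d\<in>J. k d \<le> N \<and> d = h * real (k d) / 2 ^ n"
    using grid_common_level[OF J] by blast
  then have k: "k d \<le> N \<and> d = h * real (k d) / 2 ^ n" if "d \<in> J" for d
    using that by blast
  define incP where "incP w = (\<lambda>i\<in>{..<N}. P (h * real (Suc i) / 2 ^ n) w - P (h * real i / 2 ^ n) w)" for w
  define incQ where "incQ w = (\<lambda>i\<in>{..<N}. Q (h * real (Suc i) / 2 ^ n) w - Q (h * real i / 2 ^ n) w)" for w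
  have g: "h * real j / 2 ^ n \<in> grid h" for j by (auto simp: grid_def)
  have iP[measurable]: "incP \<in> M1 \<rightarrow>\<^sub>M PiM {..<N} (\<lambda>_. borel)"
    and iQ[measurable]: "incQ \<in> M2 \<rightarrow>\<^sub>M PiM {..<N} (\<lambda>_. borel)"
    unfolding incP_def incQ_def
    by (intro measurable_restrict borel_measurable_diff P(1) Q(1) g)+
  have law: "distr M1 (PiM {..<N} (\<lambda>_. borel)) incP = distr M2 (PiM {..<N} (\<lambda>_. borel)) incQ"
  proof (rule measure_eqI_PiM_finite[where A="\<lambda>_. space (PiM {..<N} (\<lambda>_. borel))"])
    fix A :: "nat \<Rightarrow> 'a set" assume A: "\<And>i. i \<in> {..<N} \<Longrightarrow> A i \<in> sets borel"
    define A' where "A' i = (if i < N then A i else UNIV)" for i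
    have A': "A' i \<in> sets borel" for i using A by (simp add: A'_def)
    have "incP -` Pi\<^sub>E {..<N} A \<inter> space M1 =
        {w \<in> space M1. \<forall>i<N. P (h * real (Suc i) / 2 ^ n) w - P (h * real i / 2 ^ n) w \<in> A' i}"
      "incQ -` Pi\<^sub>E {..<N} A \<inter> space M2 =
        {w \<in> space M2. \<forall>i<N. Q (h * real (Suc i) / 2 ^ n) w - Q (h * real i / 2 ^ n) w \<in> A' i}"
      unfolding incP_def incQ_def vimage_def restrict_PiE_iff by (auto simp: A'_def simp del: of_nat_Suc)
    then show "emeasure (distr M1 (PiM {..<N} (\<lambda>_. borel)) incP) (Pi\<^sub>E {..<N} A) =
        emeasure (distr M2 (PiM {..<N} (\<lambda>_. borel)) incQ) (Pi\<^sub>E {..<N} A)"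
      using eq[OF A', of N n] A
      by (simp add: emeasure_distr sets_PiM_I_finite del: of_nat_Suc)
  next
    show "range (\<lambda>_. space (PiM {..<N} (\<lambda>_. borel :: 'a measure))) \<subseteq> prod_algebra {..<N} (\<lambda>_. borel)"
      by (auto simp: space_PiM intro!: prod_algebraI_finite)
    show "emeasure (distr M1 (PiM {..<N} (\<lambda>_. borel)) incP) (space (PiM {..<N} (\<lambda>_. borel))) \<noteq> \<infinity>" for i :: nat
      using prob_space.emeasure_space_1[OF prob_space.prob_space_distr[OF M1 iP]] by simp
  qed auto
  define S where "S = {z \<in> space (PiM {..<N} (\<lambda>_. borel :: 'a measure)). \<forall>d\<in>J. (\<Sum>i<k d. z i) \<in> A d}"
  have "{z \<in> space (PiM {..<N} (\<lambda>_. borel :: 'a measure)). (\<Sum>i<k d. z i) \<in> A d} \<in> sets (PiM {..<N} (\<lambda>_. borel))"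
    if "d \<in> J" for d
  proof -
    have [measurable]: "A d \<in> sets borel" using A that .
    have "(\<lambda>z. \<Sum>i<k d. z i) \<in> borel_measurable (PiM {..<N} (\<lambda>_. borel :: 'a measure))"
      using k[OF that] by (intro borel_measurable_sum measurable_component_singleton) auto
    then show ?thesis by measurable
  qed
  then have S: "S \<in> sets (PiM {..<N} (\<lambda>_. borel))"
    unfolding S_def using J(1) by (intro sets.sets_Collect_finite_All) auto
  have telescope: "p d = (\<Sum>i<k d. (\<lambda>i\<in>{..<N}. p (h * real (Suc i) / 2 ^ n) - p (h * real i / 2 ^ n)) i)"
    if "d \<in> J" "p 0 = 0" for d and p :: "real \<Rightarrow> 'a"
  proof -
    have "(\<Sum>i<k d. (\<lambda>i\<in>{..<N}. p (h * real (Suc i) / 2 ^ n) - p (h * real i / 2 ^ n)) i) =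
      (\<Sum>i<k d. p (h * real (Suc i) / 2 ^ n) - p (h * real i / 2 ^ n))"
      using k[OF that(1)] by (intro sum.cong) auto
    also have "\<dots> = p (h * real (k d) / 2 ^ n) - p (h * real 0 / 2 ^ n)"
      by (rule sum_lessThan_telescope)
    finally show ?thesis using k[OF that(1)] that(2) by simp
  qed
  have sumP: "(\<Sum>i<k d. incP w i) = P d w" if "d \<in> J" "w \<in> space M1" for d w
    using telescope[OF that(1), of "\<lambda>d. P d w"] P(2)[OF that(2)] by (simp only: incP_def)
  have sumQ: "(\<Sum>i<k d. incQ w i) = Q d w" if "d \<in> J" "w \<in> space M2" for d w
    using telescope[OF that(1), of "\<lambda>d. Q d w"] Q(2)[OF that(2)] by (simp only: incQ_def)
  have "grid h \<inter> J = J" using J(2) by auto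
  then have cyl: "restrict p (grid h) \<in> prod_emb (grid h) (\<lambda>_. borel) J (Pi\<^sub>E J A) \<longleftrightarrow> (\<forall>d\<in>J. p d \<in> A d)"
    for p :: "real \<Rightarrow> 'a"
    by (simp add: prod_emb_def restrict_PiE_iff Pi_iff)
  have "(\<lambda>w. restrict (\<lambda>d. P d w) (grid h)) -` prod_emb (grid h) (\<lambda>_. borel) J (Pi\<^sub>E J A) \<inter> space M1 =
      {w \<in> space M1. \<forall>d\<in>J. P d w \<in> A d}"
    by (auto simp: cyl)
  also have "\<dots> = incP -` S \<inter> space M1"
    using sumP measurable_space[OF iP] by (auto simp: S_def)
  finally have *: "(\<lambda>w. restrict (\<lambda>d. P d w) (grid h)) -` prod_emb (grid h) (\<lambda>_. borel) J (Pi\<^sub>E J A) \<inter> space M1 =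
    incP -` S \<inter> space M1" .
  have "(\<lambda>w. restrict (\<lambda>d. Q d w) (grid h)) -` prod_emb (grid h) (\<lambda>_. borel) J (Pi\<^sub>E J A) \<inter> space M2 =
      {w \<in> space M2. \<forall>d\<in>J. Q d w \<in> A d}"
    by (auto simp: cyl)
  also have "\<dots> = incQ -` S \<inter> space M2"
    using sumQ measurable_space[OF iQ] by (auto simp: S_def)
  finally have **: "(\<lambda>w. restrict (\<lambda>d. Q d w) (grid h)) -` prod_emb (grid h) (\<lambda>_. borel) J (Pi\<^sub>E J A) \<inter> space M2 =
    incQ -` S \<inter> space M2" .
  have "prod_emb (grid h) (\<lambda>_. borel) J (Pi\<^sub>E J A) \<in> sets (PiM (grid h) (\<lambda>_. borel))"
    using J A by (intro sets_PiM_I) auto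
  then show "emeasure (distr M1 (PiM (grid h) (\<lambda>_. borel)) (\<lambda>w. restrict (\<lambda>d. P d w) (grid h)))
       (prod_emb (grid h) (\<lambda>_. borel) J (Pi\<^sub>E J A)) =
     emeasure (distr M2 (PiM (grid h) (\<lambda>_. borel)) (\<lambda>w. restrict (\<lambda>d. Q d w) (grid h)))
       (prod_emb (grid h) (\<lambda>_. borel) J (Pi\<^sub>E J A))"
    using arg_cong[OF law, of "\<lambda>\<mu>. emeasure \<mu> S"] S
    by (simp add: emeasure_distr mP mQ * ** iP iQ)
qed (simp_all)

section \<open>The Markov property of the survival function\<close>

definition gaussian_law :: "real \<Rightarrow> 'a :: euclidean_space measure" where
  "gaussian_law v = density lborel (\<lambda>y. ennreal (\<Prod>b\<in>Basis. normal_density 0 (sqrt v) (y \<bullet> b)))"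

text \<open>
  The probability that a Brownian particle started at \<open>x\<close> and killed at rate \<open>U\<close> is alive at time \<open>t\<close>.
\<close>

definition survival ::
  "'w measure \<Rightarrow> (real \<Rightarrow> 'w \<Rightarrow> 'a) \<Rightarrow> ('a :: euclidean_space \<Rightarrow> real) \<Rightarrow> real \<Rightarrow> 'a \<Rightarrow> real" where
  "survival M B U t x = (LINT \<omega>|M. exp (- energy U t x (\<lambda>s. B s \<omega>)))"

context brownian_motion
begin

lemma emeasure_increment:
  assumes "0 \<le> s" "s < t" "A \<in> sets borel"
  shows "emeasure M {\<omega> \<in> space M. B t \<omega> - B s \<omega> \<in> A} = emeasure (gaussian_law (t - s)) A"
proof -
  have "distr M lborel (\<lambda>\<omega>. B t \<omega> - B s \<omega>) = gaussian_law (t - s)"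
    and m: "(\<lambda>\<omega>. B t \<omega> - B s \<omega>) \<in> M \<rightarrow>\<^sub>M lborel"
    using gaussian_increments[OF assms(1,2)] by (simp_all add: distributed_def gaussian_law_def)
  then have "emeasure (gaussian_law (t - s)) A = emeasure M ((\<lambda>\<omega>. B t \<omega> - B s \<omega>) -` A \<inter> space M)"
    using emeasure_distr[OF m] assms(3) by simp
  also have "(\<lambda>\<omega>. B t \<omega> - B s \<omega>) -` A \<inter> space M = {\<omega> \<in> space M. B t \<omega> - B s \<omega> \<in> A}"
    by auto
  finally show ?thesis by simp
qed

lemma emeasure_grid_increments:
  assumes q: "0 < q" and A: "\<And>i. A i \<in> sets borel"
  shows "emeasure M {\<omega> \<in> space M. \<forall>i<N. B (q * real (Suc i)) \<omega> - B (q * real i) \<omega> \<in> A i} =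
    (\<Prod>i<N. emeasure (gaussian_law q) (A i))"
proof (cases "N = 0")
  case True
  then show ?thesis by (simp add: emeasure_space_1)
next
  case False
  define X where "X i \<omega> = B (q * real (Suc i)) \<omega> - B (q * real i) \<omega>" for i \<omega>
  have "indep_vars (\<lambda>_. borel) X {..<N}"
    unfolding X_def using q by (intro independent_increments) auto
  then have "prob (\<Inter>i\<in>{..<N}. X i -` A i \<inter> space M) = (\<Prod>i<N. prob (X i -` A i \<inter> space M))"
    using False A by (intro indep_varsD_finite) auto
  moreover have "(\<Inter>i\<in>{..<N}. X i -` A i \<inter> space M) = {\<omega> \<in> space M. \<forall>i<N. X i \<omega> \<in> A i}"
    using False by auto
  ultimately have "emeasure M {\<omega> \<in> space M. \<forall>i<N. X i \<omega> \<in> A i} = (\<Prod>i<N. emeasure M (X i -` A i \<inter> space M))"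
    by (simp add: emeasure_eq_measure prod_ennreal)
  also have "\<dots> = (\<Prod>i<N. emeasure (gaussian_law q) (A i))"
  proof (intro prod.cong refl)
    fix i
    have "X i -` A i \<inter> space M = {\<omega> \<in> space M. B (q * real (Suc i)) \<omega> - B (q * real i) \<omega> \<in> A i}"
      by (auto simp: X_def)
    also have "emeasure M \<dots> = emeasure (gaussian_law (q * real (Suc i) - q * real i)) (A i)"
      using q A by (intro emeasure_increment) auto
    also have "q * real (Suc i) - q * real i = q" by (simp add: algebra_simps)
    finally show "emeasure M (X i -` A i \<inter> space M) = emeasure (gaussian_law q) (A i)" .
  qed
  finally show ?thesis by (simp add: X_def)
qed

text \<open>
  On the product space the second sample is an independent copy of Brownian motion. That this
  process has the law of \<open>B\<close> on the grid is the form of the Markov property used below: it turns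
  conditioning on the past into an iterated integral over two samples.
\<close>

definition restart :: "real \<Rightarrow> real \<Rightarrow> 'w \<times> 'w \<Rightarrow> 'a" where
  "restart h s w = (if s \<le> h then B s (fst w) else B h (fst w) + B (s - h) (snd w))"

lemma restart_shift: "0 \<le> s \<Longrightarrow> w \<in> space (M \<Otimes>\<^sub>M M) \<Longrightarrow> restart h (h + s) w = B h (fst w) + B s (snd w)"
  using start[of "snd w"] by (auto simp: restart_def space_pair_measure)

lemma continuous_restart:
  assumes "0 \<le> h" and w: "w \<in> space (M \<Otimes>\<^sub>M M)"
  shows "continuous_on {0..} (\<lambda>s. restart h s w)"
proof -
  have w': "fst w \<in> space M" "snd w \<in> space M" using w by (auto simp: space_pair_measure)
  have "continuous_on ({0..h} \<union> {h..}) (\<lambda>s. if s \<le> h then B s (fst w) else B h (fst w) + B (s - h) (snd w))"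
  proof (rule continuous_on_If)
    show "continuous_on {0..h} (\<lambda>s. B s (fst w))"
      by (rule continuous_on_subset[OF continuous_paths[OF w'(1)]]) auto
    show "continuous_on {h..} (\<lambda>s. B h (fst w) + B (s - h) (snd w))"
      by (intro continuous_intros continuous_on_compose2[OF continuous_paths[OF w'(2)]]) auto
  qed (use start[OF w'(2)] in auto)
  moreover have "{0..h} \<union> {h..} = {0..}" using assms by auto
  ultimately show ?thesis by (simp add: restart_def)
qed

lemma measurable_restart: "0 \<le> h \<Longrightarrow> 0 \<le> s \<Longrightarrow> restart h s \<in> borel_measurable (M \<Otimes>\<^sub>M M)"
  unfolding restart_def
  by (cases "s \<le> h") (auto intro!: borel_measurable_add measurable_compose[OF measurable_fst measurable_B]
     measurable_compose[OF measurable_snd measurable_B])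

lemma measurable_sample:
  assumes "0 < h"
  shows "(\<lambda>\<omega>. restrict (\<lambda>d. B d \<omega>) (grid h)) \<in> M \<rightarrow>\<^sub>M PiM (grid h) (\<lambda>_. borel)"
  by (intro measurable_restrict measurable_B grid_nonneg[OF assms])

lemma measurable_restart_sample:
  assumes "0 < h"
  shows "(\<lambda>w. restrict (\<lambda>d. restart h d w) (grid h)) \<in> M \<Otimes>\<^sub>M M \<rightarrow>\<^sub>M PiM (grid h) (\<lambda>_. borel)"
  by (intro measurable_restrict) (simp add: measurable_restart grid_nonneg[OF assms] less_imp_le[OF assms])

text \<open>
  Since \<open>h\<close> is itself a point of each mesh, no mesh interval straddles \<open>h\<close>: each increment of the
  restarted process is an increment of exactly one of the two samples. Rectangles therefore
  factor, and both sides are products of the same Gaussian measures.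
\<close>

lemma law_restart:
  assumes h: "0 < h"
  shows "distr M (PiM (grid h) (\<lambda>_. borel)) (\<lambda>\<omega>. restrict (\<lambda>d. B d \<omega>) (grid h)) =
    distr (M \<Otimes>\<^sub>M M) (PiM (grid h) (\<lambda>_. borel)) (\<lambda>w. restrict (\<lambda>d. restart h d w) (grid h))"
proof (rule grid_law_eqI)
  interpret MM: pair_prob_space M M ..
  show "prob_space M" "prob_space (M \<Otimes>\<^sub>M M)" by unfold_locales
  show "B d \<in> borel_measurable M" if "d \<in> grid h" for d
    by (rule measurable_B[OF grid_nonneg[OF h that]])
  show "restart h d \<in> borel_measurable (M \<Otimes>\<^sub>M M)" if "d \<in> grid h" for d
    using h grid_nonneg[OF h that] by (intro measurable_restart) auto
  show "restart h 0 w = 0" if "w \<in> space (M \<Otimes>\<^sub>M M)" for w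
    using that h by (auto simp: restart_def space_pair_measure start)
  fix n N :: nat and A :: "nat \<Rightarrow> 'a set" assume A: "\<And>i. A i \<in> sets borel"
  define q where "q = h / 2 ^ n"
  define m :: nat where "m = 2 ^ n"
  have q: "0 < q" "q * real m = h" using h by (auto simp: q_def m_def)
  have hq: "h * c / 2 ^ n = q * c" for c by (simp add: q_def)
  define E where "E K f = {\<omega> \<in> space M. \<forall>i<K. B (q * real (Suc i)) \<omega> - B (q * real i) \<omega> \<in> A (f i)}"
    for K and f :: "nat \<Rightarrow> nat"
  have E: "E K f \<in> sets M" "emeasure M (E K f) = (\<Prod>i<K. emeasure (gaussian_law q) (A (f i)))" for K f
  proof -
    have [measurable]: "B (q * real i) \<in> borel_measurable M" for i
      using q by (intro measurable_B) auto
    have [measurable]: "A i \<in> sets borel" for i by (rule A)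
    show "E K f \<in> sets M"
      unfolding E_def by measurable
    show "emeasure M (E K f) = (\<Prod>i<K. emeasure (gaussian_law q) (A (f i)))"
      unfolding E_def by (rule emeasure_grid_increments[OF q(1) A])
  qed
  have early: "restart h (q * real (Suc i)) w - restart h (q * real i) w =
      B (q * real (Suc i)) (fst w) - B (q * real i) (fst w)" if "i < m" for i w
  proof -
    have "q * real (Suc i) \<le> q * real m" "q * real i \<le> q * real m"
      using that q by (auto intro!: mult_left_mono simp del: of_nat_Suc)
    then show ?thesis by (simp add: restart_def q)
  qed
  have late: "restart h (q * real (Suc (m + j))) w - restart h (q * real (m + j)) w =
      B (q * real (Suc j)) (snd w) - B (q * real j) (snd w)" if "w \<in> space (M \<Otimes>\<^sub>M M)" for j w
  proof -
    have "q * real (Suc (m + j)) = h + q * real (Suc j)" "q * real (m + j) = h + q * real j"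
      using q(2) by (simp_all add: algebra_simps)
    then show ?thesis
      using restart_shift[OF _ that, of "q * real (Suc j)" h] restart_shift[OF _ that, of "q * real j" h] q(1)
      by simp
  qed
  have split: "(\<forall>i<N. Q i) \<longleftrightarrow> (\<forall>i<min N m. Q i) \<and> (\<forall>j<N - m. Q (m + j))" for Q
  proof (intro iffI conjI allI impI)
    fix i assume *: "(\<forall>i<min N m. Q i) \<and> (\<forall>j<N - m. Q (m + j))" and "i < N"
    show "Q i"
    proof (cases "i < m")
      case False
      then have "Q (m + (i - m))" using * \<open>i < N\<close> by (intro *[THEN conjunct2, rule_format]) linarith
      then show ?thesis using False by simp
    qed (use * \<open>i < N\<close> in simp)
  qed auto
  have "{w \<in> space (M \<Otimes>\<^sub>M M). \<forall>i<N. restart h (q * real (Suc i)) w - restart h (q * real i) w \<in> A i} =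
      E (min N m) id \<times> E (N - m) (\<lambda>j. m + j)"
    unfolding E_def by (subst split) (auto simp: space_pair_measure early late simp del: of_nat_Suc of_nat_add)
  then have "emeasure (M \<Otimes>\<^sub>M M)
      {w \<in> space (M \<Otimes>\<^sub>M M). \<forall>i<N. restart h (q * real (Suc i)) w - restart h (q * real i) w \<in> A i} =
      emeasure M (E (min N m) id) * emeasure M (E (N - m) (\<lambda>j. m + j))"
    by (simp add: emeasure_pair_measure_Times E)
  also have "\<dots> = (\<Prod>i<N. emeasure (gaussian_law q) (A i))"
  proof (cases "N \<le> m")
    case False
    define g where "g i = emeasure (gaussian_law q) (A i)" for i
    have "(\<Prod>i<N. g i) = (\<Prod>i\<in>{0..<m}. g i) * (\<Prod>i\<in>{m..<N}. g i)"
      using False prod.atLeastLessThan_concat[of 0 m N g] by (simp add: lessThan_atLeast0)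
    also have "(\<Prod>i\<in>{m..<N}. g i) = (\<Prod>j\<in>{0..<N - m}. g (m + j))"
      using False prod.shift_bounds_nat_ivl[of g 0 m "N - m"] by (simp add: add.commute)
    finally show ?thesis
      using False by (simp add: E g_def lessThan_atLeast0)
  qed (simp add: E)
  also have "\<dots> = emeasure M (E N id)" by (simp add: E)
  finally show "emeasure M {\<omega> \<in> space M. \<forall>i<N. B (h * real (Suc i) / 2 ^ n) \<omega> - B (h * real i / 2 ^ n) \<omega> \<in> A i} =
      emeasure (M \<Otimes>\<^sub>M M)
      {w \<in> space (M \<Otimes>\<^sub>M M). \<forall>i<N. restart h (h * real (Suc i) / 2 ^ n) w - restart h (h * real i / 2 ^ n) w \<in> A i}"
    by (simp add: hq E_def del: of_nat_Suc)
qed (rule start)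

lemma energy_sample:
  assumes "0 < h" "\<omega> \<in> space M"
  shows "energy U t x (skeleton_path h (restrict (\<lambda>d. B d \<omega>) (grid h))) = energy U t x (\<lambda>s. B s \<omega>)"
  by (rule energy_cong) (simp add: skeleton_path_eq[OF assms(1) continuous_paths[OF assms(2)]])

lemma measurable_path:
  assumes [measurable]: "g \<in> N \<rightarrow>\<^sub>M M" "s \<in> borel_measurable N" and "\<And>z. z \<in> space N \<Longrightarrow> 0 \<le> s z"
  shows "(\<lambda>z. B (s z) (g z)) \<in> borel_measurable N"
proof -
  have "(\<lambda>z. skeleton_path 1 (restrict (\<lambda>d. B d (g z)) (grid 1)) (s z)) \<in> borel_measurable N"
    by (rule measurable_skeleton_path[OF measurable_compose[OF assms(1) measurable_sample]]) auto
  also have "?this \<longleftrightarrow> ?thesis"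
    using assms(3) measurable_space[OF assms(1)]
    by (intro measurable_cong) (simp add: skeleton_path_eq[OF _ continuous_paths])
  finally show ?thesis .
qed

lemma measurable_energy:
  assumes "U \<in> borel_measurable borel"
    and [measurable]: "g \<in> N \<rightarrow>\<^sub>M M" "t \<in> borel_measurable N" "x \<in> borel_measurable N"
  shows "(\<lambda>z. energy U (t z) (x z) (\<lambda>s. B s (g z))) \<in> borel_measurable N"
proof -
  have "(\<lambda>z. energy U (t z) (x z) (skeleton_path 1 (restrict (\<lambda>d. B d (g z)) (grid 1)))) \<in> borel_measurable N"
    by (rule measurable_energy_skeleton_path[OF assms(1) measurable_compose[OF assms(2) measurable_sample]]) auto
  also have "?this \<longleftrightarrow> ?thesis"
    using measurable_space[OF assms(2)]
    by (intro measurable_cong) (simp add: energy_sample)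
  finally show ?thesis .
qed

lemma measurable_survival:
  assumes U: "U \<in> borel_measurable borel"
    and [measurable]: "t \<in> borel_measurable N" "x \<in> borel_measurable N"
  shows "(\<lambda>z. survival M B U (t z) (x z)) \<in> borel_measurable N"
proof -
  have [measurable]: "(\<lambda>w. energy U (t (fst w)) (x (fst w)) (\<lambda>s. B s (snd w))) \<in> borel_measurable (N \<Otimes>\<^sub>M M)"
    by (intro measurable_energy[OF U]) measurable
  show ?thesis
    unfolding survival_def by (rule borel_measurable_lebesgue_integral) (simp add: split_beta)
qed

lemma integrable_exp_energy:
  assumes U: "locally_bounded_potential U"
  shows "integrable M (\<lambda>\<omega>. exp (- energy U t x (\<lambda>s. B s \<omega>)))"
proof (rule integrable_const_bound[where B=1])
  show "(\<lambda>\<omega>. exp (- energy U t x (\<lambda>s. B s \<omega>))) \<in> borel_measurable M"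
    using U by (intro measurable_compose[OF _ borel_measurable_exp] borel_measurable_uminus measurable_energy)
      (auto simp: locally_bounded_potential_def)
qed (simp add: energy_nonneg[OF U])

lemma survival_nonneg: "0 \<le> survival M B U t x"
  unfolding survival_def by (intro integral_nonneg_AE AE_I2) simp

lemma survival_le_1:
  assumes U: "locally_bounded_potential U"
  shows "survival M B U t x \<le> 1"
proof -
  have "survival M B U t x \<le> (LINT \<omega>|M. 1)"
    unfolding survival_def by (intro integral_mono integrable_exp_energy[OF U]) (auto simp: energy_nonneg[OF U])
  then show ?thesis by (simp add: prob_space)
qed

lemma survival_antimono:
  assumes U: "locally_bounded_potential U" and "t \<le> t'"
  shows "survival M B U t' x \<le> survival M B U t x"
  unfolding survival_def
  by (intro integral_mono integrable_exp_energy[OF U]) (simp add: energy_mono[OF U continuous_paths assms(2)])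

lemma survival_Markov:
  assumes U: "locally_bounded_potential U" and h: "0 < h" "h \<le> t"
  shows "survival M B U t x =
    (LINT \<omega>|M. exp (- energy U h x (\<lambda>s. B s \<omega>)) * survival M B U (t - h) (x + B h \<omega>))"
proof -
  interpret MM: pair_prob_space M M ..
  have [measurable]: "U \<in> borel_measurable borel" using U by (simp add: locally_bounded_potential_def)
  let ?P = "PiM (grid h) (\<lambda>_. borel :: 'a measure)"
  have [measurable]: "(\<lambda>f. exp (- energy U t x (skeleton_path h f))) \<in> borel_measurable ?P"
    by (intro measurable_compose[OF _ borel_measurable_exp] borel_measurable_uminus measurable_energy_skeleton_path) auto
  have "survival M B U t x = (LINT \<omega>|M. exp (- energy U t x (skeleton_path h (restrict (\<lambda>d. B d \<omega>) (grid h)))))"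
    unfolding survival_def by (intro Bochner_Integration.integral_cong refl) (simp add: energy_sample[OF h(1)])
  also have "\<dots> = (LINT f|distr M ?P (\<lambda>\<omega>. restrict (\<lambda>d. B d \<omega>) (grid h)). exp (- energy U t x (skeleton_path h f)))"
    by (rule integral_distr[symmetric, OF measurable_sample[OF h(1)]]) measurable
  also have "\<dots> = (LINT w|(M \<Otimes>\<^sub>M M). exp (- energy U t x (skeleton_path h (restrict (\<lambda>d. restart h d w) (grid h)))))"
    unfolding law_restart[OF h(1)]
    by (rule integral_distr[OF measurable_restart_sample[OF h(1)]]) measurable
  also have "\<dots> = (LINT w|(M \<Otimes>\<^sub>M M). exp (- energy U h x (\<lambda>s. B s (fst w))) *
      exp (- energy U (t - h) (x + B h (fst w)) (\<lambda>s. B s (snd w))))"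
  proof (intro Bochner_Integration.integral_cong refl)
    fix w assume w: "w \<in> space (M \<Otimes>\<^sub>M M)"
    have cont: "continuous_on {0..} (\<lambda>s. restart h s w)"
      using h(1) by (intro continuous_restart w) simp
    have "energy U t x (skeleton_path h (restrict (\<lambda>d. restart h d w) (grid h))) = energy U t x (\<lambda>s. restart h s w)"
      by (rule energy_cong) (simp add: skeleton_path_eq[OF h(1) cont])
    also have "\<dots> = energy U h x (\<lambda>s. restart h s w) +
        energy U (t - h) (x + restart h h w) (\<lambda>s. restart h (h + s) w - restart h h w)"
      using h by (intro energy_split[OF U cont]) auto
    also have "energy U h x (\<lambda>s. restart h s w) = energy U h x (\<lambda>s. B s (fst w))"
      by (rule energy_cong) (simp add: restart_def)
    also have "energy U (t - h) (x + restart h h w) (\<lambda>s. restart h (h + s) w - restart h h w) =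
        energy U (t - h) (x + B h (fst w)) (\<lambda>s. B s (snd w))"
      by (rule energy_cong) (simp add: restart_shift[OF _ w] restart_def[of h h])
    finally show "exp (- energy U t x (skeleton_path h (restrict (\<lambda>d. restart h d w) (grid h)))) =
      exp (- energy U h x (\<lambda>s. B s (fst w))) * exp (- energy U (t - h) (x + B h (fst w)) (\<lambda>s. B s (snd w)))"
      by (simp only: mult_exp_exp minus_add_distrib)
  qed
  also have "\<dots> = (LINT \<omega>|M. LINT \<omega>'|M. exp (- energy U h x (\<lambda>s. B s \<omega>)) *
      exp (- energy U (t - h) (x + B h \<omega>) (\<lambda>s. B s \<omega>')))"
  proof (subst MM.integral_fst'[symmetric])
    have [measurable]: "B h \<in> borel_measurable M" using h by (intro measurable_B) simp
    have [measurable]: "(\<lambda>w. energy U h x (\<lambda>s. B s (fst w))) \<in> borel_measurable (M \<Otimes>\<^sub>M M)"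
      "(\<lambda>w. energy U (t - h) (x + B h (fst w)) (\<lambda>s. B s (snd w))) \<in> borel_measurable (M \<Otimes>\<^sub>M M)"
      by (intro measurable_energy; measurable)+
    show "integrable (M \<Otimes>\<^sub>M M) (\<lambda>w. exp (- energy U h x (\<lambda>s. B s (fst w))) *
      exp (- energy U (t - h) (x + B h (fst w)) (\<lambda>s. B s (snd w))))"
    proof (rule MM.integrable_const_bound[where B=1])
      have "exp (- energy U h x p) * exp (- energy U t' y p') \<le> 1" for t' y p p'
        by (intro mult_le_one) (simp_all add: energy_nonneg[OF U])
      then show "AE w in M \<Otimes>\<^sub>M M. norm (exp (- energy U h x (\<lambda>s. B s (fst w))) *
          exp (- energy U (t - h) (x + B h (fst w)) (\<lambda>s. B s (snd w)))) \<le> 1"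
        by (intro AE_I2) (simp only: real_norm_def abs_mult abs_exp_cancel)
    qed measurable
  qed simp
  also have "\<dots> = (LINT \<omega>|M. exp (- energy U h x (\<lambda>s. B s \<omega>)) * survival M B U (t - h) (x + B h \<omega>))"
    unfolding survival_def by simp
  finally show ?thesis .
qed

end

section \<open>A Gaussian bound for the running maximum\<close>

lemma normal_density_tilt:
  assumes "0 < v"
  shows "normal_density 0 (sqrt v) y * exp (y\<^sup>2 / (4 * v)) = sqrt 2 * normal_density 0 (sqrt (2 * v)) y"
proof -
  have "exp (- (y\<^sup>2 / (2 * v))) * exp (y\<^sup>2 / (4 * v)) = exp (- (y\<^sup>2 / (4 * v)))"
    unfolding mult_exp_exp using assms by (simp add: field_simps)
  moreover have "sqrt (4 * pi * v) = sqrt 2 * sqrt (2 * pi * v)"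
    by (simp add: real_sqrt_mult[symmetric])
  ultimately show ?thesis
    using assms by (simp add: normal_density_def field_simps)
qed

text \<open>
  An exponential Chebyshev bound: tilting the density by \<open>exp (\<bar>y\<bar>\<^sup>2 / (4 * v))\<close> doubles the variance.
  Half of the optimal exponent is lost, but the estimate treats all coordinates at once, so the
  dimension only enters the constant.
\<close>

lemma gaussian_density_tail:
  fixes y :: "'a :: euclidean_space"
  assumes v: "0 < v" and r: "0 \<le> r" "r \<le> norm y"
  shows "(\<Prod>b\<in>Basis. normal_density 0 (sqrt v) (y \<bullet> b)) \<le>
    sqrt 2 ^ DIM('a) * exp (- r\<^sup>2 / (4 * v)) * (\<Prod>b\<in>Basis. normal_density 0 (sqrt (2 * v)) (y \<bullet> b))"
proof -
  let ?f = "\<lambda>v. \<Prod>b\<in>Basis. normal_density 0 (sqrt v) (y \<bullet> b)"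
  have "(norm y)\<^sup>2 = (\<Sum>b\<in>Basis. (y \<bullet> b)\<^sup>2)"
    unfolding power2_norm_eq_inner by (subst euclidean_inner) (simp add: power2_eq_square)
  then have "exp ((norm y)\<^sup>2 / (4 * v)) = (\<Prod>b\<in>Basis. exp ((y \<bullet> b)\<^sup>2 / (4 * v)))"
    by (simp add: sum_divide_distrib exp_sum)
  then have tilt: "?f v * exp ((norm y)\<^sup>2 / (4 * v)) = sqrt 2 ^ DIM('a) * ?f (2 * v)"
    by (simp add: prod.distrib[symmetric] normal_density_tilt[OF v] prod_constant[symmetric] del: prod_constant)
  have "r\<^sup>2 / (4 * v) \<le> (norm y)\<^sup>2 / (4 * v)"
    using v r by (intro divide_right_mono power_mono) auto
  then have "1 \<le> exp ((norm y)\<^sup>2 / (4 * v)) * exp (- r\<^sup>2 / (4 * v))"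
    unfolding mult_exp_exp by simp
  then have "?f v * 1 \<le> ?f v * (exp ((norm y)\<^sup>2 / (4 * v)) * exp (- r\<^sup>2 / (4 * v)))"
    by (intro mult_left_mono prod_nonneg) auto
  also have "\<dots> = (?f v * exp ((norm y)\<^sup>2 / (4 * v))) * exp (- r\<^sup>2 / (4 * v))"
    by simp
  finally show ?thesis
    unfolding tilt by (simp add: mult_ac)
qed

lemma (in brownian_motion) increment_tail:
  assumes st: "0 \<le> s" "s < t" and r: "0 \<le> r"
  shows "emeasure M {\<omega> \<in> space M. r \<le> norm (B t \<omega> - B s \<omega>)} \<le>
    ennreal (sqrt 2 ^ DIM('a) * exp (- r\<^sup>2 / (4 * (t - s))))"
proof -
  define v where "v = t - s"
  have v: "0 < v" using st by (simp add: v_def)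
  let ?f = "\<lambda>v y. \<Prod>b\<in>Basis. normal_density 0 (sqrt v) (y \<bullet> b :: real)"
  let ?c = "sqrt 2 ^ DIM('a) * exp (- r\<^sup>2 / (4 * v))"
  \<comment> \<open>The tilted density has mass one because it is itself the density of an increment, over a time \<open>2 * v\<close>.\<close>
  have total: "(\<integral>\<^sup>+y. ennreal (?f (2 * v) y) \<partial>(lborel :: 'a measure)) = 1"
  proof -
    have "emeasure (gaussian_law (2 * v - 0)) (UNIV :: 'a set) = emeasure M {\<omega> \<in> space M. B (2 * v) \<omega> - B 0 \<omega> \<in> UNIV}"
      using v by (intro emeasure_increment[symmetric]) auto
    then show ?thesis
      by (simp add: gaussian_law_def emeasure_density emeasure_space_1)
  qed
  have "{\<omega> \<in> space M. r \<le> norm (B t \<omega> - B s \<omega>)} = {\<omega> \<in> space M. B t \<omega> - B s \<omega> \<in> {y. r \<le> norm y}}"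
    by auto
  also have "emeasure M \<dots> = emeasure (gaussian_law v) {y :: 'a. r \<le> norm y}"
    unfolding v_def using st by (intro emeasure_increment) auto
  also have "\<dots> = (\<integral>\<^sup>+y. ennreal (?f v y) * indicator {y. r \<le> norm y} y \<partial>(lborel :: 'a measure))"
    by (simp add: gaussian_law_def emeasure_density)
  also have "\<dots> \<le> (\<integral>\<^sup>+y. ennreal ?c * ennreal (?f (2 * v) y) \<partial>(lborel :: 'a measure))"
  proof (rule nn_integral_mono)
    fix y :: 'a
    show "ennreal (?f v y) * indicator {y. r \<le> norm y} y \<le> ennreal ?c * ennreal (?f (2 * v) y)"
      using gaussian_density_tail[OF v r, of y]
      by (auto simp: indicator_def ennreal_mult'[symmetric] simp del: ennreal_mult'' intro!: ennreal_leI)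
  qed
  also have "\<dots> = ennreal ?c"
    by (subst nn_integral_cmult) (simp_all add: total)
  finally show ?thesis by (simp add: v_def)
qed

text \<open>
  The weights sum to one, while \<open>(chaining_weight k)\<^sup>2 * 2 ^ k = (9 / 8) ^ k / 16\<close> still grows: the
  Gaussian bound for the \<open>2 ^ k\<close> increments of level \<open>k\<close> then beats their number.
\<close>

definition chaining_weight :: "nat \<Rightarrow> real" where
  "chaining_weight k = 1 / 4 * (3 / 4) ^ k"

lemma sum_chaining_weight_le: "(\<Sum>k\<le>n. chaining_weight k) \<le> 1"
proof -
  have "(\<Sum>k\<le>n. chaining_weight k) = 1 - (3 / 4) ^ Suc n"
    by (induction n) (simp_all add: chaining_weight_def)
  then show ?thesis by simp
qed

text \<open>
  A dyadic point of level \<open>n\<close> is joined to \<open>0\<close> by at most one mesh increment from each level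
  \<open>k \<le> n\<close>, so its norm is at most \<open>r\<close> times a partial sum of the weights; continuity gives the rest.
\<close>

lemma chaining_bound:
  fixes p :: "real \<Rightarrow> 'a :: euclidean_space"
  assumes h: "0 < h" and r: "0 \<le> r" and p: "continuous_on {0..} p" "p 0 = 0"
    and inc: "\<And>k j. j < 2 ^ k \<Longrightarrow> norm (p (h * real (Suc j) / 2 ^ k) - p (h * real j / 2 ^ k)) \<le> r * chaining_weight k"
    and q: "q \<in> {0..h}"
  shows "norm (p q) \<le> r"
proof -
  have grid: "norm (p (h * real j / 2 ^ n)) \<le> r * (\<Sum>k\<le>n. chaining_weight k)" if "j \<le> 2 ^ n" for j n
    using that
  proof (induction n arbitrary: j)
    case 0
    then have "j = 0 \<or> j = 1" by auto
    then show ?case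
      using inc[of 0 0] p(2) r by (auto simp: chaining_weight_def)
  next
    case (Suc n)
    have w: "0 \<le> r * chaining_weight (Suc n)" using r by (simp add: chaining_weight_def)
    have half: "h * real (2 * i) / 2 ^ Suc n = h * real i / 2 ^ n" for i by simp
    obtain i where "j = 2 * i \<or> j = Suc (2 * i)" by (metis evenE oddE Suc_eq_plus1)
    then show ?case
    proof
      assume j: "j = 2 * i"
      then show ?thesis
        using Suc.IH[of i] Suc.prems w unfolding j half by (simp add: distrib_left)
    next
      assume j: "j = Suc (2 * i)"
      then have i: "2 * i < 2 ^ Suc n" "i \<le> 2 ^ n" using Suc.prems by auto
      have "norm (p (h * real j / 2 ^ Suc n)) \<le>
          norm (p (h * real j / 2 ^ Suc n) - p (h * real (2 * i) / 2 ^ Suc n)) + norm (p (h * real i / 2 ^ n))"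
        unfolding half by (metis norm_triangle_sub add.commute)
      also have "\<dots> \<le> r * chaining_weight (Suc n) + r * (\<Sum>k\<le>n. chaining_weight k)"
        using inc[OF i(1)] Suc.IH[OF i(2)] unfolding j by (intro add_mono)
      finally show ?thesis by (simp add: distrib_left)
    qed
  qed
  have "norm (p (grid_time h n q)) \<le> r" for n
  proof -
    have "q * 2 ^ n / h \<le> 2 ^ n" using q h by (simp add: field_simps)
    then have "nat \<lfloor>q * 2 ^ n / h\<rfloor> \<le> 2 ^ n"
      by (simp add: nat_le_iff floor_le_iff)
    then have "norm (p (grid_time h n q)) \<le> r * (\<Sum>k\<le>n. chaining_weight k)"
      unfolding grid_time_def by (rule grid)
    also have "\<dots> \<le> r * 1"
      by (intro mult_left_mono sum_chaining_weight_le r)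
    finally show ?thesis by simp
  qed
  moreover have "(\<lambda>n. norm (p (grid_time h n q))) \<longlonglongrightarrow> norm (p (max 0 q))"
    by (intro tendsto_norm continuous_on_tendsto_compose[OF p(1) grid_time_tendsto[OF h]])
      (auto intro!: always_eventually grid_nonneg[OF h grid_time_in_grid])
  ultimately have "norm (p (max 0 q)) \<le> r"
    by (intro LIMSEQ_le_const2) auto
  then show ?thesis using q by simp
qed

lemma summable_chaining_tail: "summable (\<lambda>k. 2 ^ k * exp (- ((9 / 8) ^ k - 1) / 4) :: real)"
proof (rule summable_comparison_test_bigo)
  show "summable (\<lambda>k. norm ((1 / 2 :: real) ^ k))" by simp
  show "(\<lambda>k. 2 ^ k * exp (- ((9 / 8) ^ k - 1) / 4) :: real) \<in> O(\<lambda>k. (1 / 2) ^ k)"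
    by real_asymp
qed

text \<open>
  A union bound over the dyadic increments of all levels. The time horizon \<open>1 / 16\<close> is
  chosen so that level \<open>k\<close> contributes the exponent
  \<open>- r\<^sup>2 * (9 / 8) ^ k / 4\<close>, hence the sum over \<open>k\<close> is of order \<open>exp (- r\<^sup>2 / 4)\<close>. This is at most
  \<open>exp (- r\<^sup>2 / (4 * d))\<close>, which has the form of the weight in \<open>I_fun\<close>.
\<close>

lemma (in brownian_motion) path_tail:
  obtains K :: real where "1 \<le> K"
    and "\<And>r. 0 \<le> r \<Longrightarrow> \<exists>E\<in>sets M. emeasure M E \<le> ennreal (K * exp (- r\<^sup>2 / 4)) \<and>
      (\<forall>\<omega>\<in>space M - E. \<forall>q\<in>{0..1 / 16}. norm (B q \<omega>) \<le> r)"
proof -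
  \<comment> \<open>For \<open>r < 1\<close> the claim is trivial with the constant \<open>exp (1 / 4)\<close>; the series handles \<open>r \<ge> 1\<close>.\<close>
  define D where "D = sqrt 2 ^ DIM('a)"
  define K1 where "K1 = (\<Sum>k. 2 ^ k * exp (- ((9 / 8) ^ k - 1) / 4) :: real)"
  define K where "K = max (D * K1) (exp (1 / 4))"
  have D: "0 \<le> D" by (simp add: D_def)
  have "\<exists>E\<in>sets M. emeasure M E \<le> ennreal (K * exp (- r\<^sup>2 / 4)) \<and>
      (\<forall>\<omega>\<in>space M - E. \<forall>q\<in>{0..1 / 16}. norm (B q \<omega>) \<le> r)" if r: "0 \<le> r" for r
  proof (cases "r < 1")
    case True
    have "r\<^sup>2 \<le> 1" using True r by (simp add: power_le_one)
    then have "1 \<le> exp (1 / 4) * exp (- r\<^sup>2 / 4)"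
      unfolding mult_exp_exp by simp
    also have "\<dots> \<le> K * exp (- r\<^sup>2 / 4)"
      by (intro mult_right_mono) (auto simp: K_def)
    finally show ?thesis
      by (intro bexI[of _ "space M"]) (auto simp: emeasure_space_1)
  next
    case False
    then have r1: "1 \<le> r" by simp
    define time where "time k j = 1 / 16 * real j / 2 ^ k" for k j :: nat
    define E where "E k j = {\<omega> \<in> space M. r * chaining_weight k \<le> norm (B (time k (Suc j)) \<omega> - B (time k j) \<omega>)}"
      for k j
    have [measurable]: "B (time k j) \<in> borel_measurable M" for k j
      by (intro measurable_B) (simp add: time_def)
    have E[measurable]: "E k j \<in> sets M" for k j
      unfolding E_def by measurable
    define T where "T k = D * (2 ^ k * exp (- ((9 / 8) ^ k - 1) / 4)) * exp (- r\<^sup>2 / 4)" for k :: nat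
    have level: "emeasure M (\<Union>j<2 ^ k. E k j) \<le> ennreal (T k)" for k
    proof -
      have len: "time k (Suc j) - time k j = 1 / 16 / 2 ^ k" for j
        by (simp add: time_def diff_divide_distrib[symmetric])
      have e: "(r * chaining_weight k)\<^sup>2 / (4 * (1 / 16 / 2 ^ k)) = r\<^sup>2 * (9 / 8) ^ k / 4"
      proof -
        have "((3 / 4) ^ k)\<^sup>2 * 2 ^ k = ((9 / 8) ^ k :: real)"
          by (simp add: power2_eq_square power_mult_distrib[symmetric])
        then show ?thesis
          by (simp add: chaining_weight_def power_mult_distrib power2_eq_square field_simps)
      qed
      have "emeasure M (E k j) \<le> ennreal (D * exp (- (r\<^sup>2 * (9 / 8) ^ k / 4)))" for j
      proof -
        have "time k j < time k (Suc j)" "0 \<le> time k j" using len[of j] by (simp_all add: time_def divide_strict_right_mono)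
        then have "emeasure M (E k j) \<le>
            ennreal (D * exp (- (r * chaining_weight k)\<^sup>2 / (4 * (time k (Suc j) - time k j))))"
          unfolding E_def D_def using r by (intro increment_tail) (auto simp: chaining_weight_def)
        then show ?thesis unfolding len by (simp only: e minus_divide_left[symmetric])
      qed
      then have "emeasure M (\<Union>j<2 ^ k. E k j) \<le> (\<Sum>j\<in>{..<2 ^ k :: nat}. ennreal (D * exp (- (r\<^sup>2 * (9 / 8) ^ k / 4))))"
        by (intro order_trans[OF emeasure_subadditive_finite] sum_mono) auto
      also have "\<dots> = ennreal (D * (2 ^ k * exp (- (r\<^sup>2 * (9 / 8) ^ k / 4))))"
        using D by (simp add: ennreal_of_nat_eq_real_of_nat ennreal_mult'[symmetric] mult_ac)
      also have "\<dots> \<le> ennreal (T k)"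
      proof -
        have "1 * ((9 / 8) ^ k - 1) \<le> r\<^sup>2 * ((9 / 8) ^ k - 1 :: real)"
          using r1 by (intro mult_right_mono) auto
        then have "- (r\<^sup>2 * (9 / 8) ^ k / 4) \<le> - ((9 / 8) ^ k - 1) / 4 + - r\<^sup>2 / 4"
          by (simp add: algebra_simps)
        then have "exp (- (r\<^sup>2 * (9 / 8) ^ k / 4)) \<le> exp (- ((9 / 8) ^ k - 1) / 4) * exp (- r\<^sup>2 / 4)"
          unfolding mult_exp_exp by simp
        then have "D * (2 ^ k * exp (- (r\<^sup>2 * (9 / 8) ^ k / 4))) \<le>
            D * (2 ^ k * (exp (- ((9 / 8) ^ k - 1) / 4) * exp (- r\<^sup>2 / 4)))"
          using D by (intro mult_left_mono) auto
        then show ?thesis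
          by (intro ennreal_leI) (simp add: T_def mult_ac)
      qed
      finally show ?thesis .
    qed
    have "T sums (D * K1 * exp (- r\<^sup>2 / 4))"
      unfolding T_def K1_def
      by (intro sums_mult sums_mult2 summable_sums summable_chaining_tail)
    moreover have "0 \<le> T k" for k using D by (simp add: T_def)
    ultimately have "(\<Sum>k. ennreal (T k)) = ennreal (D * K1 * exp (- r\<^sup>2 / 4))"
      by (intro suminf_ennreal_eq)
    moreover have "emeasure M (\<Union>k. \<Union>j<2 ^ k. E k j) \<le> (\<Sum>k. emeasure M (\<Union>j<2 ^ k. E k j))"
      by (intro emeasure_subadditive_countably) auto
    moreover have "(\<Sum>k. emeasure M (\<Union>j<2 ^ k. E k j)) \<le> (\<Sum>k. ennreal (T k))"
      by (intro suminf_le level) auto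
    moreover have "ennreal (D * K1 * exp (- r\<^sup>2 / 4)) \<le> ennreal (K * exp (- r\<^sup>2 / 4))"
      by (intro ennreal_leI mult_right_mono) (auto simp: K_def)
    ultimately have "emeasure M (\<Union>k. \<Union>j<2 ^ k. E k j) \<le> ennreal (K * exp (- r\<^sup>2 / 4))"
      by simp
    moreover have "norm (B q \<omega>) \<le> r" if w: "\<omega> \<in> space M - (\<Union>k. \<Union>j<2 ^ k. E k j)" and q: "q \<in> {0..1 / 16}" for \<omega> q
    proof (rule chaining_bound[where h="1 / 16"])
      show "continuous_on {0..} (\<lambda>s. B s \<omega>)" "B 0 \<omega> = 0"
        using w continuous_paths start by auto
      fix k j :: nat assume "j < 2 ^ k"
      then have "\<omega> \<notin> E k j" using w by auto
      then show "norm (B (1 / 16 * real (Suc j) / 2 ^ k) \<omega> - B (1 / 16 * real j / 2 ^ k) \<omega>) \<le> r * chaining_weight k"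
        using w unfolding E_def time_def by auto
    qed (use r q in auto)
    ultimately show ?thesis
      by (intro bexI[of _ "\<Union>k. \<Union>j<2 ^ k. E k j"]) auto
  qed
  moreover have "1 \<le> K" by (simp add: K_def le_max_iff_disj)
  ultimately show ?thesis by (rule that[rotated])
qed

section \<open>Power integrals and a layer cake inequality\<close>

lemma nn_integral_powr_Icc:
  assumes "0 < a" "0 \<le> h"
  shows "(\<integral>\<^sup>+t\<in>{0..h}. ennreal (t powr (a - 1)) \<partial>lborel) = ennreal (h powr a / a)"
  using nn_integral_has_integral_lebesgue'[OF _ has_integral_powr_from_0[of "a - 1" h]] assms by simp

lemma nn_integral_Gamma_scaled:
  assumes "0 < a" "0 < c"
  shows "(\<integral>\<^sup>+t\<in>{0..}. ennreal (exp (- (c * t)) * t powr (a - 1)) \<partial>lborel) = ennreal (Gamma a * c powr (- a))"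
    (is "?J = _")
proof -
  have "ennreal (Gamma a) = (\<integral>\<^sup>+t. ennreal (indicator {0..} t * t powr (a - 1) / exp t) \<partial>lborel)"
    by (rule Gamma_conv_nn_integral_real[OF assms(1)])
  also have "\<dots> = ennreal \<bar>c\<bar> * (\<integral>\<^sup>+t. ennreal (indicator {0..} (0 + c * t) * (0 + c * t) powr (a - 1) / exp (0 + c * t)) \<partial>lborel)"
    using assms by (intro nn_integral_real_affine) auto
  also have "(\<integral>\<^sup>+t. ennreal (indicator {0..} (0 + c * t) * (0 + c * t) powr (a - 1) / exp (0 + c * t)) \<partial>lborel) =
      (\<integral>\<^sup>+t. ennreal (c powr (a - 1)) * (ennreal (exp (- (c * t)) * t powr (a - 1)) * indicator {0..} t) \<partial>lborel)"
    using assms by (intro nn_integral_cong)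
      (auto simp: indicator_def zero_le_mult_iff powr_mult exp_minus field_simps ennreal_mult'[symmetric])
  also have "\<dots> = ennreal (c powr (a - 1)) * ?J"
    by (rule nn_integral_cmult) measurable
  also have "ennreal \<bar>c\<bar> * (ennreal (c powr (a - 1)) * ?J) = ennreal (c powr a) * ?J"
    using assms powr_mult_base[of c "a - 1"]
    by (simp add: mult.assoc[symmetric] ennreal_mult'[symmetric])
  finally have "ennreal (c powr (- a)) * ennreal (Gamma a) = ennreal (c powr (- a)) * (ennreal (c powr a) * ?J)"
    by simp
  also have "\<dots> = ?J"
    using assms by (simp add: mult.assoc[symmetric] ennreal_mult'[symmetric] powr_minus)
  finally show ?thesis
    using assms by (simp add: ennreal_mult'[symmetric] mult.commute)
qed

text \<open>
  The level set in \<open>s\<close> is the interval from \<open>1\<close> to the \<open>\<sigma> \<le> v\<close> with \<open>K * \<sigma> powr a = G\<close> (if \<open>G \<ge> K\<close>),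
  and integrating \<open>s powr (a - 1)\<close> over it gives \<open>(\<sigma> powr a - 1) / a\<close>. The inequality is the reason
  for the integral over \<open>[1, V x]\<close> in \<open>I_fun\<close>.
\<close>

lemma layer_cake_powr:
  fixes G :: ennreal
  assumes K: "0 < K" and a: "0 < a" and v: "1 \<le> v" and G: "G \<le> ennreal (K * v powr a)"
  shows "G \<le> ennreal K + ennreal (K * a) *
    (\<integral>\<^sup>+s\<in>{1..v}. ennreal (s powr (a - 1)) * of_bool (ennreal (K * s powr a) \<le> G) \<partial>lborel)"
    (is "_ \<le> _ + _ * ?I")
proof -
  obtain g where g: "G = ennreal g" "0 \<le> g"
    using G by (cases G) (auto simp: top_unique)
  have gv: "g \<le> K * v powr a"
    using G K unfolding g(1) by (subst (asm) ennreal_le_iff) auto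
  show ?thesis
  proof (cases "g \<le> K")
    case True
    then show ?thesis unfolding g(1) by (intro order_trans[OF ennreal_leI add_increasing2]) auto
  next
    case False
    define \<sigma> where "\<sigma> = (g / K) powr (1 / a)"
    have \<sigma>a: "K * \<sigma> powr a = g"
      using K a False by (simp add: \<sigma>_def powr_powr)
    have "1 \<le> \<sigma>"
      unfolding \<sigma>_def using K a False by (intro ge_one_powr_ge_zero) auto
    have "\<sigma> powr a \<le> v powr a"
      using gv K unfolding \<sigma>a[symmetric] by simp
    then have "\<sigma> \<le> v"
      using a v \<open>1 \<le> \<sigma>\<close> by (metis not_le powr_less_mono2 dual_order.trans zero_le_one)
    have "ennreal (\<sigma> powr a / a - 1 powr a / a) = (\<integral>\<^sup>+s. ennreal (s powr (a - 1)) * indicator {1..\<sigma>} s \<partial>lborel)"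
    proof (rule nn_integral_FTC_Icc[symmetric])
      show "((\<lambda>s. s powr a / a) has_real_derivative s powr (a - 1)) (at s)" if "s \<in> {1..\<sigma>}" for s
        using that a by (auto intro!: derivative_eq_intros)
    qed (use \<open>1 \<le> \<sigma>\<close> in auto)
    also have "\<dots> \<le> ?I"
    proof (rule nn_integral_mono)
      fix s :: real
      have "K * s powr a \<le> g" if "s \<in> {1..\<sigma>}"
        using that a K unfolding \<sigma>a[symmetric] by (intro mult_left_mono powr_mono2) auto
      then show "ennreal (s powr (a - 1)) * indicator {1..\<sigma>} s \<le>
          ennreal (s powr (a - 1)) * of_bool (ennreal (K * s powr a) \<le> G) * indicator {1..v} s"
        using \<open>\<sigma> \<le> v\<close> by (auto simp: indicator_def g(1) intro!: ennreal_leI)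
    qed
    finally have I: "ennreal (\<sigma> powr a / a - 1 / a) \<le> ?I" by simp
    have "1 \<le> \<sigma> powr a" using \<open>1 \<le> \<sigma>\<close> a by (intro ge_one_powr_ge_zero) auto
    have "G = ennreal (K + K * a * (\<sigma> powr a / a - 1 / a))"
      using a \<sigma>a by (simp add: g(1) field_simps)
    also have "\<dots> = ennreal K + ennreal (K * a) * ennreal (\<sigma> powr a / a - 1 / a)"
      using K a \<open>1 \<le> \<sigma> powr a\<close> by (simp add: ennreal_plus ennreal_mult divide_right_mono)
    also have "\<dots> \<le> ennreal K + ennreal (K * a) * ?I"
      by (intro add_left_mono mult_left_mono I) auto
    finally show ?thesis .
  qed
qed

section \<open>The radius rho and its Gaussian weight\<close>

text \<open>
  The radius \<open>0\<close> always belongs to the set whose supremum is \<open>rho V x u\<close>, so that the supremum is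
  not \<open>- \<infinity>\<close>.
\<close>

lemma zero_admissible: "AE y in lebesgue. y \<in> cball x 0 \<longrightarrow> V x / u \<le> (V y :: real)" if "1 \<le> u" "0 \<le> V x"
proof -
  have "V x / u \<le> V x" using that mult_right_mono[of 1 u "V x"] by (simp add: field_simps)
  have "AE y in lborel. y \<noteq> x" by (rule AE_lborel_singleton)
  then show ?thesis
    using \<open>V x / u \<le> V x\<close> by (intro AE_completion) auto
qed

lemma rho_nonneg: "1 \<le> u \<Longrightarrow> 0 \<le> V x \<Longrightarrow> 0 \<le> rho V x u"
  unfolding rho_def zero_ereal_def
  by (rule SUP_upper, rule CollectI, intro conjI order_refl zero_admissible)

lemma rho_mono:
  assumes "1 \<le> u" "u \<le> u'" "0 \<le> V x"
  shows "rho V x u \<le> rho V x u'"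
  unfolding rho_def
proof (rule SUP_subset_mono)
  have "V x / u' \<le> V x / u" using assms by (intro divide_left_mono) auto
  then show "{r. 0 \<le> r \<and> (AE y in lebesgue. y \<in> cball x r \<longrightarrow> V x / u \<le> V y)} \<subseteq>
      {r. 0 \<le> r \<and> (AE y in lebesgue. y \<in> cball x r \<longrightarrow> V x / u' \<le> V y)}"
    by (auto elim!: eventually_mono)
qed simp

lemma gauss_weight_antimono:
  fixes V :: "'a :: euclidean_space \<Rightarrow> real"
  assumes "1 \<le> u" "u \<le> u'" "0 \<le> V x"
  shows "gauss_weight V x u' \<le> gauss_weight V x u"
proof (cases "rho V x u' = \<infinity>")
  case False
  have "0 \<le> rho V x u" "rho V x u \<le> rho V x u'"
    using assms by (auto intro: rho_nonneg rho_mono)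
  then obtain r r' where r: "rho V x u = ereal r" "rho V x u' = ereal r'" "0 \<le> r" "r \<le> r'"
    using False by (cases "rho V x u"; cases "rho V x u'") auto
  then have "r\<^sup>2 / (4 * real DIM('a)) \<le> r'\<^sup>2 / (4 * real DIM('a))"
    by (intro divide_right_mono power_mono) auto
  then show ?thesis using r by (simp add: gauss_weight_def)
qed (simp add: gauss_weight_def)

lemma gauss_weight_bounds: "0 \<le> gauss_weight V x u" "gauss_weight V x u \<le> 1"
  by (auto simp: gauss_weight_def)

lemma I_fun_nonneg: "0 \<le> I_fun a V x"
  unfolding I_fun_def set_lebesgue_integral_def
  by (intro integral_nonneg_AE AE_I2) (simp add: gauss_weight_bounds)

lemma measurable_I_fun_integrand:
  fixes V :: "'a :: euclidean_space \<Rightarrow> real"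
  assumes "0 \<le> V x"
  shows "(\<lambda>s. indicator {1..v} s *\<^sub>R (s powr (a - 1) * gauss_weight V x s)) \<in> borel_measurable lborel"
proof -
  have "mono (\<lambda>s. - gauss_weight V x (max 1 s))"
    using assms by (intro monoI) (auto intro!: gauss_weight_antimono)
  then have "(\<lambda>s. - gauss_weight V x (max 1 s)) \<in> borel_measurable borel"
    by (rule borel_measurable_mono)
  then have "(\<lambda>s. - (- gauss_weight V x (max 1 s))) \<in> borel_measurable borel"
    by (rule borel_measurable_uminus)
  then have [measurable]: "(\<lambda>s. gauss_weight V x (max 1 s)) \<in> borel_measurable borel"
    by simp
  have "(\<lambda>s. indicator {1..v} s *\<^sub>R (s powr (a - 1) * gauss_weight V x (max 1 s))) \<in> borel_measurable lborel"
    by measurable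
  also have "(\<lambda>s. indicator {1..v} s *\<^sub>R (s powr (a - 1) * gauss_weight V x (max 1 s))) =
      (\<lambda>s. indicator {1..v} s *\<^sub>R (s powr (a - 1) * gauss_weight V x s))"
    by (auto simp: fun_eq_iff indicator_def)
  finally show ?thesis .
qed

lemma I_fun_eq_nn_integral:
  fixes V :: "'a :: euclidean_space \<Rightarrow> real"
  assumes V: "1 \<le> V x"
  shows "(\<integral>\<^sup>+s\<in>{1..V x}. ennreal (s powr (a - 1) * gauss_weight V x s) \<partial>lborel) = ennreal (I_fun a V x)"
proof -
  let ?f = "\<lambda>s. indicator {1..V x} s *\<^sub>R (s powr (a - 1) * gauss_weight V x s)"
  have m: "?f \<in> borel_measurable lborel"
    using V by (intro measurable_I_fun_integrand) simp
  have b: "s powr (a - 1) * gauss_weight V x s \<le> max 1 (V x powr (a - 1))" if "s \<in> {1..V x}" for s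
  proof -
    have "s powr (a - 1) \<le> max 1 (V x powr (a - 1))"
    proof (cases "1 \<le> a")
      case True
      then have "s powr (a - 1) \<le> V x powr (a - 1)" using that by (intro powr_mono2) auto
      then show ?thesis by simp
    next
      case False
      then have "s powr (a - 1) \<le> s powr 0" using that by (intro powr_mono) auto
      then show ?thesis using that by simp
    qed
    moreover have "s powr (a - 1) * gauss_weight V x s \<le> s powr (a - 1) * 1"
      by (intro mult_left_mono gauss_weight_bounds) auto
    ultimately show ?thesis by linarith
  qed
  have "integrable lborel ?f"
  proof (rule integrableI_bounded_set[where A="{1..V x}" and B="max 1 (V x powr (a - 1))"])
    show "AE s in lborel. s \<in> {1..V x} \<longrightarrow> norm (?f s) \<le> max 1 (V x powr (a - 1))"
    proof (intro AE_I2 impI)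
      fix s assume s: "s \<in> {1..V x}"
      have "norm (?f s) = s powr (a - 1) * gauss_weight V x s"
        using s by (simp add: gauss_weight_bounds abs_mult)
      then show "norm (?f s) \<le> max 1 (V x powr (a - 1))" using b[OF s] by simp
    qed
  qed (use m in \<open>auto simp: emeasure_lborel_Icc_eq\<close>)
  then have "(\<integral>\<^sup>+s. ennreal (?f s) \<partial>lborel) = ennreal (LINT s|lborel. ?f s)"
    by (rule nn_integral_eq_integral) (simp add: gauss_weight_bounds)
  moreover have "(LINT s|lborel. ?f s) = I_fun a V x"
    using V by (simp only: I_fun_def set_lebesgue_integral_def max_absorb2)
  moreover have "(\<integral>\<^sup>+s\<in>{1..V x}. ennreal (s powr (a - 1) * gauss_weight V x s) \<partial>lborel) = (\<integral>\<^sup>+s. ennreal (?f s) \<partial>lborel)"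
    by (intro nn_integral_cong) (auto simp: indicator_def)
  ultimately show ?thesis by (simp only:)
qed

text \<open>
  The supremum defining \<open>rho\<close> need not be attained, and it may be infinite. A bound available for each
  admissible radius passes to the supremum by continuity, with limit \<open>0\<close> when the radius is infinite.
\<close>

lemma le_gauss_weightI:
  fixes V :: "'a :: euclidean_space \<Rightarrow> real"
  assumes u: "1 \<le> u" and V: "0 \<le> V x" and C: "0 \<le> C"
    and p: "\<And>r. 0 \<le> r \<Longrightarrow> AE y in lebesgue. y \<in> cball x r \<longrightarrow> V x / u \<le> V y \<Longrightarrow> p \<le> C * exp (- r\<^sup>2 / 4)"
  shows "p \<le> C * gauss_weight V x u"
proof -
  have below: "p \<le> C * exp (- (max 0 y)\<^sup>2 / 4)" if "ereal y < rho V x u" for y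
  proof -
    from that obtain r where "r \<in> {r. 0 \<le> r \<and> (AE y in lebesgue. y \<in> cball x r \<longrightarrow> V x / u \<le> V y)}"
      and "ereal y < ereal r"
      unfolding rho_def less_SUP_iff by blast
    then have r: "y < r" "0 \<le> r" "AE y in lebesgue. y \<in> cball x r \<longrightarrow> V x / u \<le> V y"
      by simp_all
    have "(max 0 y)\<^sup>2 \<le> r\<^sup>2" using r by (intro power_mono) auto
    then have "C * exp (- r\<^sup>2 / 4) \<le> C * exp (- (max 0 y)\<^sup>2 / 4)" using C by (intro mult_left_mono) auto
    with p[OF r(2,3)] show ?thesis by linarith
  qed
  show ?thesis
  proof (cases "rho V x u = \<infinity>")
    case True
    then have "p \<le> C * exp (- (max 0 (real n))\<^sup>2 / 4)" for n :: nat by (intro below) simp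
    moreover have "(\<lambda>n. C * exp (- (max 0 (real n))\<^sup>2 / 4)) \<longlonglongrightarrow> C * 0"
      by (intro tendsto_mult tendsto_const) real_asymp
    ultimately have "p \<le> C * 0" by (intro LIMSEQ_le_const) auto
    then show ?thesis using True by (simp add: gauss_weight_def)
  next
    case False
    then obtain \<rho> where \<rho>: "rho V x u = ereal \<rho>" "0 \<le> \<rho>"
      using rho_nonneg[OF u, of V x] V by (cases "rho V x u") auto
    have "p \<le> C * exp (- (max 0 (\<rho> - 1 / real (Suc n)))\<^sup>2 / 4)" for n by (intro below) (simp add: \<rho>)
    moreover have "(\<lambda>n. C * exp (- (max 0 (\<rho> - 1 / real (Suc n)))\<^sup>2 / 4)) \<longlonglongrightarrow> C * exp (- (max 0 (\<rho> - 0))\<^sup>2 / 4)"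
      by (intro tendsto_intros tendsto_max LIMSEQ_Suc[OF lim_1_over_n]) simp
    ultimately have "p \<le> C * exp (- (max 0 (\<rho> - 0))\<^sup>2 / 4)" by (intro LIMSEQ_le_const) auto
    also have "\<dots> \<le> C * exp (- \<rho>\<^sup>2 / (4 * real DIM('a)))"
    proof -
      have "\<rho>\<^sup>2 / (4 * real DIM('a)) \<le> \<rho>\<^sup>2 / (4 * 1)"
        by (intro divide_left_mono mult_left_mono) auto
      then show ?thesis using C \<rho> by (intro mult_left_mono) auto
    qed
    finally show ?thesis using \<rho> by (simp add: gauss_weight_def)
  qed
qed

context brownian_motion
begin

section \<open>Almost every path avoids null sets\<close>

lemma AE_not_in_null_set:
  assumes N: "N \<in> null_sets lborel" and q: "0 < q"
  shows "AE \<omega> in M. x + B q \<omega> \<notin> N"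
proof (rule AE_I')
  define N' where "N' = {y. x + y \<in> N}"
  have [measurable]: "N \<in> sets borel" using N by auto
  have N'[measurable]: "N' \<in> sets borel" unfolding N'_def by measurable
  have "emeasure lborel N' = emeasure (distr lborel borel ((+) x)) N"
    by (subst emeasure_distr) (auto simp: N'_def vimage_def)
  then have "N' \<in> null_sets lborel"
    using N by (simp add: lborel_distr_plus null_sets_def)
  moreover have "absolutely_continuous lborel (gaussian_law q :: 'a measure)"
    unfolding gaussian_law_def by (rule absolutely_continuousI_density) measurable
  ultimately have "emeasure (gaussian_law q) N' = 0"
    unfolding absolutely_continuous_def by auto
  then have "emeasure M {\<omega> \<in> space M. B q \<omega> - B 0 \<omega> \<in> N'} = 0"
    using emeasure_increment[of 0 q N'] q by simp
  moreover have "{\<omega> \<in> space M. B q \<omega> - B 0 \<omega> \<in> N'} = {\<omega> \<in> space M. x + B q \<omega> \<in> N}"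
    by (auto simp: N'_def start)
  moreover have "{\<omega> \<in> space M. x + B q \<omega> \<in> N} \<in> sets M"
  proof -
    have [measurable]: "B q \<in> borel_measurable M" using q by (intro measurable_B) simp
    show ?thesis by measurable
  qed
  ultimately show "{\<omega> \<in> space M. x + B q \<omega> \<in> N} \<in> null_sets M"
    by (simp add: null_sets_def)
qed auto

text \<open>
  By Fubini's theorem almost every path spends zero time in a given null set. This is what permits
  almost everywhere statements about \<open>V\<close> to be used inside the integral along a path.
\<close>

lemma AE_along_path:
  assumes P: "AE y in lborel. P y"
  shows "AE \<omega> in M. AE q in lborel. 0 \<le> q \<longrightarrow> P (x + B q \<omega>)"
proof -
  interpret path_time: pair_sigma_finite M lborel ..
  obtain N where N: "N \<in> null_sets lborel" "{y \<in> space lborel. \<not> P y} \<subseteq> N"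
    using P unfolding eventually_ae_filter by blast
  then have [measurable]: "N \<in> sets borel" by auto
  have [measurable]: "(\<lambda>w. B (max 0 (snd w)) (fst w)) \<in> borel_measurable (M \<Otimes>\<^sub>M lborel)"
    by (rule measurable_path) auto
  have "AE q in lborel. AE \<omega> in M. 0 < q \<longrightarrow> x + B (max 0 q) \<omega> \<notin> N"
  proof (rule AE_I2)
    fix q :: real
    show "AE \<omega> in M. 0 < q \<longrightarrow> x + B (max 0 q) \<omega> \<notin> N"
      using AE_not_in_null_set[OF N(1), of q x] by (cases "0 < q") auto
  qed
  then have "AE \<omega> in M. AE q in lborel. 0 < q \<longrightarrow> x + B (max 0 q) \<omega> \<notin> N"
    by (subst path_time.AE_commute) measurable
  then show ?thesis
  proof eventually_elim
    case (elim \<omega>)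
    moreover have "AE q in lborel. q \<noteq> (0::real)" by (rule AE_lborel_singleton)
    ultimately show ?case
      by eventually_elim (use N(2) in \<open>auto simp: max_def\<close>)
  qed
qed

text \<open>
  Replacing \<open>V\<close> by its Borel representative changes the path integral only for a null set of paths, at
  every starting point. Thereby the integrals over completed measures become ordinary ones.
\<close>

lemma schrodinger_semigroup_eq_survival:
  assumes U: "locally_bounded_potential U" and eq: "AE y in lborel. V y = U y"
  shows "schrodinger_semigroup M B V t (\<lambda>_. 1) x = survival M B U t x"
  unfolding schrodinger_semigroup_def survival_def mult_1_right
proof (rule integral_completion_AE_eq)
  show "(\<lambda>\<omega>. exp (- energy U t x (\<lambda>s. B s \<omega>))) \<in> borel_measurable M"
    by (rule borel_measurable_integrable[OF integrable_exp_energy[OF U]])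
  show "AE \<omega> in M. exp (- (LINT s:{0..t}|lebesgue. V (x + B s \<omega>))) = exp (- energy U t x (\<lambda>s. B s \<omega>))"
    using AE_along_path[OF eq, of x] AE_space
  proof eventually_elim
    case (elim \<omega>)
    have "integrable lborel (\<lambda>s. indicator {0..t} s *\<^sub>R U (x + B s \<omega>))"
      using energy_integrable[OF U continuous_paths[OF elim(2)]] by (simp add: set_integrable_def)
    moreover have "AE s in lborel. indicator {0..t} s *\<^sub>R V (x + B s \<omega>) = indicator {0..t} s *\<^sub>R U (x + B s \<omega>)"
      using elim(1) by eventually_elim (auto simp: indicator_def)
    ultimately have "(LINT s:{0..t}|lebesgue. V (x + B s \<omega>)) = energy U t x (\<lambda>s. B s \<omega>)"
      unfolding energy_def set_lebesgue_integral_def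
      by (intro integral_completion_AE_eq borel_measurable_integrable)
    then show ?case by simp
  qed
qed

text \<open>
  In the Markov property the factor \<open>survival M B U (t - h) (x + B h \<omega>)\<close> is at most \<open>D\<close> for almost
  every \<open>\<omega>\<close>, as \<open>B h\<close> has a density. The factor that remains is the survival up to time \<open>h\<close>. Note that
  the conclusion holds at every \<open>x\<close> although the bound is known only almost everywhere.
\<close>

lemma survival_decay:
  assumes U: "locally_bounded_potential U" and h: "0 < h" "h \<le> t"
    and D: "AE y in lborel. survival M B U (t - h) y \<le> D"
  shows "survival M B U t x \<le> D * survival M B U h x"
proof -
  have [measurable]: "U \<in> borel_measurable borel" using U by (simp add: locally_bounded_potential_def)
  have [measurable]: "B h \<in> borel_measurable M" using h by (intro measurable_B) simp
  have m: "(\<lambda>\<omega>. survival M B U (t - h) (x + B h \<omega>)) \<in> borel_measurable M"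
    by (rule measurable_survival) auto
  obtain N where N: "N \<in> null_sets lborel" "{y \<in> space lborel. \<not> survival M B U (t - h) y \<le> D} \<subseteq> N"
    using D unfolding eventually_ae_filter by blast
  have "survival M B U t x =
      (LINT \<omega>|M. exp (- energy U h x (\<lambda>s. B s \<omega>)) * survival M B U (t - h) (x + B h \<omega>))"
    by (rule survival_Markov[OF U h])
  also have "\<dots> \<le> (LINT \<omega>|M. exp (- energy U h x (\<lambda>s. B s \<omega>)) * D)"
  proof (rule integral_mono_AE)
    show "integrable M (\<lambda>\<omega>. exp (- energy U h x (\<lambda>s. B s \<omega>)) * survival M B U (t - h) (x + B h \<omega>))"
    proof (rule integrable_const_bound[where B=1])
      have "exp (- energy U h x p) * survival M B U (t - h) y \<le> 1" for p y
        by (intro mult_le_one) (simp_all add: energy_nonneg[OF U] survival_nonneg survival_le_1[OF U])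
      then show "AE \<omega> in M. norm (exp (- energy U h x (\<lambda>s. B s \<omega>)) * survival M B U (t - h) (x + B h \<omega>)) \<le> 1"
        by (intro AE_I2) (simp add: abs_mult survival_nonneg)
    qed (intro borel_measurable_times m borel_measurable_integrable[OF integrable_exp_energy[OF U]])
    show "integrable M (\<lambda>\<omega>. exp (- energy U h x (\<lambda>s. B s \<omega>)) * D)"
      by (intro integrable_mult_left integrable_exp_energy[OF U])
    show "AE \<omega> in M. exp (- energy U h x (\<lambda>s. B s \<omega>)) * survival M B U (t - h) (x + B h \<omega>) \<le>
        exp (- energy U h x (\<lambda>s. B s \<omega>)) * D"
      using AE_not_in_null_set[OF N(1) h(1), of x] by eventually_elim (use N(2) in auto)
  qed
  also have "\<dots> = D * survival M B U h x"
    by (simp add: survival_def mult.commute)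
  finally show ?thesis .
qed

section \<open>Reduction to short times, and the short-time estimate\<close>

text \<open>
  Survival beyond \<open>h\<close> costs a factor \<open>exp (- \<delta> * t)\<close> on top of survival up to \<open>h\<close>, and the latter is
  controlled by its average over \<open>[0, h]\<close> because survival decreases in time. So the large potential
  at \<open>x\<close> only has to be exploited up to time \<open>h\<close>.
\<close>

lemma survival_integral_tail:
  assumes U: "locally_bounded_potential U" and h: "0 < h" and a: "0 < a" and \<delta>: "0 < \<delta>" and D: "0 \<le> D"
    and decay: "\<And>t. 0 < t \<Longrightarrow> AE y in lborel. survival M B U t y \<le> D * exp (- (\<delta> * t))"
  shows "(\<integral>\<^sup>+t\<in>{0<..}. ennreal (survival M B U t x * t powr (a - 1)) \<partial>lborel) \<le>
    ennreal (1 + D * exp (\<delta> * h) * (Gamma a * \<delta> powr (- a)) * (a / h powr a)) *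
      (\<integral>\<^sup>+t\<in>{0..h}. ennreal (survival M B U t x * t powr (a - 1)) \<partial>lborel)"
    (is "?L \<le> _ * ?J")
proof -
  have [measurable]: "U \<in> borel_measurable borel" using U by (simp add: locally_bounded_potential_def)
  have [measurable]: "(\<lambda>t. survival M B U t x) \<in> borel_measurable borel"
    by (rule measurable_survival) auto
  let ?S = "survival M B U h x"
  let ?E = "D * exp (\<delta> * h)"
  have late: "survival M B U t x \<le> ?E * ?S * exp (- (\<delta> * t))" if "h < t" for t
  proof -
    have "survival M B U t x \<le> (D * exp (- (\<delta> * (t - h)))) * ?S"
      using that h by (intro survival_decay[OF U] decay) auto
    also have "D * exp (- (\<delta> * (t - h))) = ?E * exp (- (\<delta> * t))"
      by (simp add: mult_exp_exp algebra_simps)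
    finally show ?thesis by (simp add: mult_ac)
  qed
  have "ennreal ?S * ennreal (h powr a / a) = (\<integral>\<^sup>+t. ennreal ?S * (ennreal (t powr (a - 1)) * indicator {0..h} t) \<partial>lborel)"
    using nn_integral_powr_Icc[OF a, of h] h by (subst nn_integral_cmult) auto
  also have "\<dots> \<le> ?J"
    using survival_antimono[OF U]
    by (intro nn_integral_mono)
      (auto simp: indicator_def ennreal_mult'[symmetric] survival_nonneg intro!: ennreal_leI mult_right_mono)
  finally have S: "ennreal ?S * ennreal (h powr a / a) \<le> ?J" .
  have "ennreal ?S = ennreal (a / h powr a) * (ennreal ?S * ennreal (h powr a / a))"
    using a h by (simp add: ennreal_mult'[symmetric] survival_nonneg field_simps)
  also have "\<dots> \<le> ennreal (a / h powr a) * ?J"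
    by (intro mult_left_mono S) auto
  finally have S': "ennreal ?S \<le> ennreal (a / h powr a) * ?J" .
  have "?L \<le> (\<integral>\<^sup>+t. ennreal (survival M B U t x * t powr (a - 1)) * indicator {0..h} t +
      ennreal (?E * ?S) * (ennreal (exp (- (\<delta> * t)) * t powr (a - 1)) * indicator {0..} t) \<partial>lborel)"
  proof (rule nn_integral_mono)
    fix t :: real
    show "ennreal (survival M B U t x * t powr (a - 1)) * indicator {0<..} t \<le>
      ennreal (survival M B U t x * t powr (a - 1)) * indicator {0..h} t +
      ennreal (?E * ?S) * (ennreal (exp (- (\<delta> * t)) * t powr (a - 1)) * indicator {0..} t)"
    proof (cases "0 < t \<and> h < t")
      case True
      then have "survival M B U t x * t powr (a - 1) \<le> (?E * ?S) * (exp (- (\<delta> * t)) * t powr (a - 1))"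
        using mult_right_mono[OF late[of t], of "t powr (a - 1)"] by (simp add: mult_ac)
      then show ?thesis
        using True D by (simp add: ennreal_mult'[symmetric] survival_nonneg ennreal_leI)
    qed (auto simp: indicator_def)
  qed
  also have "\<dots> = ?J + ennreal (?E * ?S) * ennreal (Gamma a * \<delta> powr (- a))"
    by (subst nn_integral_add) (auto simp: nn_integral_cmult nn_integral_Gamma_scaled[OF a \<delta>])
  also have "ennreal (?E * ?S) * ennreal (Gamma a * \<delta> powr (- a)) = ennreal (?E * (Gamma a * \<delta> powr (- a))) * ennreal ?S"
    using D a by (simp add: ennreal_mult'[symmetric] survival_nonneg Gamma_real_pos less_imp_le mult_ac)
  also have "?J + \<dots> \<le> ?J + ennreal (?E * (Gamma a * \<delta> powr (- a))) * (ennreal (a / h powr a) * ?J)"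
    by (intro add_left_mono mult_left_mono S') auto
  also have "\<dots> = ennreal (1 + ?E * (Gamma a * \<delta> powr (- a)) * (a / h powr a)) * ?J"
  proof -
    have "J + ennreal c * (ennreal c' * J) = ennreal (1 + c * c') * J" if "0 \<le> c" "0 \<le> c'" for J c c'
      using that by (simp add: ennreal_plus ennreal_mult distrib_right mult.assoc)
    then show ?thesis
      using D a Gamma_real_pos[OF a] by simp
  qed
  finally show ?thesis .
qed

text \<open>
  Let \<open>G \<omega>\<close> be the quantity to be bounded for a single path. If the path stays within an admissible
  radius for the level \<open>s\<close>, it sees a potential at least \<open>V x / s\<close>, its energy at time \<open>t\<close> is
  at least \<open>t * V x / s\<close>, and the Gamma integral gives \<open>G \<omega> \<le> Gamma a * s powr a\<close>. Hence
  \<open>K * s powr a \<le> G \<omega>\<close> with \<open>K > Gamma a\<close> only happens if the path leaves that radius, an event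
  of probability at most \<open>C * gauss_weight V x s\<close>. Since \<open>G \<omega> \<le> K * V x powr a\<close> always holds, the
  layer cake inequality applies path by path; its expectation is at most a constant multiple of
  \<open>1 + I_fun a V x\<close>.
\<close>

lemma survival_integral_local:
  assumes U: "locally_bounded_potential U" and eq: "AE y in lborel. V y = U y"
    and a: "0 < a" and V: "1 \<le> V x" and C: "0 \<le> C"
    and tail: "\<And>r. 0 \<le> r \<Longrightarrow> \<exists>E\<in>sets M. emeasure M E \<le> ennreal (C * exp (- r\<^sup>2 / 4)) \<and>
      (\<forall>\<omega>\<in>space M - E. \<forall>q\<in>{0..h}. norm (B q \<omega>) \<le> r)"
    and h: "0 \<le> h" and K: "Gamma a < K" "h powr a / a \<le> K"
  shows "ennreal (V x powr a) * (\<integral>\<^sup>+t\<in>{0..h}. ennreal (survival M B U t x * t powr (a - 1)) \<partial>lborel) \<le>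
    ennreal (K + K * a * (C * I_fun a V x))"
proof -
  interpret path_time: pair_sigma_finite M lborel ..
  interpret time_path: pair_sigma_finite lborel M ..
  have K0: "0 < K" using K(1) Gamma_real_pos[OF a] by simp
  have [measurable]: "U \<in> borel_measurable borel" using U by (simp add: locally_bounded_potential_def)
  have [measurable]: "(\<lambda>w. energy U (snd w) x (\<lambda>s. B s (fst w))) \<in> borel_measurable (M \<Otimes>\<^sub>M lborel)"
    by (rule measurable_energy) auto
  have [measurable]: "(\<lambda>\<omega>. energy U t x (\<lambda>s. B s \<omega>)) \<in> borel_measurable M" for t
    by (rule measurable_energy) auto
  define G where "G \<omega> = ennreal (V x powr a) *
    (\<integral>\<^sup>+t\<in>{0..h}. ennreal (exp (- energy U t x (\<lambda>s. B s \<omega>)) * t powr (a - 1)) \<partial>lborel)" for \<omega>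
  have Gm[measurable]: "G \<in> borel_measurable M"
    unfolding G_def by measurable
  have surv: "ennreal (survival M B U t x) = (\<integral>\<^sup>+\<omega>. ennreal (exp (- energy U t x (\<lambda>s. B s \<omega>))) \<partial>M)" for t
    unfolding survival_def by (rule nn_integral_eq_integral[symmetric]) (auto intro: integrable_exp_energy[OF U])
  have "(\<integral>\<^sup>+t\<in>{0..h}. ennreal (survival M B U t x * t powr (a - 1)) \<partial>lborel) =
    (\<integral>\<^sup>+t. \<integral>\<^sup>+\<omega>. ennreal (exp (- energy U t x (\<lambda>s. B s \<omega>)) * t powr (a - 1)) * indicator {0..h} t \<partial>M \<partial>lborel)"
    by (intro nn_integral_cong)
      (simp add: ennreal_mult survival_nonneg surv nn_integral_multc)
  also have "\<dots> = (\<integral>\<^sup>+\<omega>. (\<integral>\<^sup>+t\<in>{0..h}. ennreal (exp (- energy U t x (\<lambda>s. B s \<omega>)) * t powr (a - 1)) \<partial>lborel) \<partial>M)"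
    by (rule path_time.Fubini') measurable
  finally have "ennreal (V x powr a) * (\<integral>\<^sup>+t\<in>{0..h}. ennreal (survival M B U t x * t powr (a - 1)) \<partial>lborel) =
      (\<integral>\<^sup>+\<omega>. G \<omega> \<partial>M)"
    unfolding G_def by (simp add: nn_integral_cmult)
  also have "\<dots> \<le> (\<integral>\<^sup>+\<omega>. ennreal K + ennreal (K * a) * (\<integral>\<^sup>+s\<in>{1..V x}.
      ennreal (s powr (a - 1)) * of_bool (ennreal (K * s powr a) \<le> G \<omega>) \<partial>lborel) \<partial>M)"
  proof (intro nn_integral_mono layer_cake_powr K0 a V)
    fix \<omega>
    have "G \<omega> \<le> ennreal (V x powr a) * (\<integral>\<^sup>+t\<in>{0..h}. ennreal (t powr (a - 1)) \<partial>lborel)"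
      unfolding G_def
      by (intro mult_left_mono nn_integral_mono)
        (auto simp: indicator_def energy_nonneg[OF U] intro!: ennreal_leI mult_left_le_one_le)
    also have "\<dots> = ennreal (V x powr a * (h powr a / a))"
      unfolding nn_integral_powr_Icc[OF a h] by (rule ennreal_mult'[symmetric]) simp
    also have "\<dots> \<le> ennreal (K * V x powr a)"
      using K(2) by (subst mult.commute) (intro ennreal_leI mult_right_mono, auto)
    finally show "G \<omega> \<le> ennreal (K * V x powr a)" .
  qed
  also have "\<dots> = ennreal K + ennreal (K * a) * (\<integral>\<^sup>+\<omega>. (\<integral>\<^sup>+s\<in>{1..V x}.
      ennreal (s powr (a - 1)) * of_bool (ennreal (K * s powr a) \<le> G \<omega>) \<partial>lborel) \<partial>M)"
    by (subst nn_integral_add) (auto simp: nn_integral_cmult emeasure_space_1)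
  also have "(\<integral>\<^sup>+\<omega>. (\<integral>\<^sup>+s\<in>{1..V x}. ennreal (s powr (a - 1)) * of_bool (ennreal (K * s powr a) \<le> G \<omega>) \<partial>lborel) \<partial>M) =
      (\<integral>\<^sup>+s. \<integral>\<^sup>+\<omega>. ennreal (s powr (a - 1)) * of_bool (ennreal (K * s powr a) \<le> G \<omega>) * indicator {1..V x} s \<partial>M \<partial>lborel)"
    by (rule time_path.Fubini') measurable
  finally have main: "ennreal (V x powr a) * (\<integral>\<^sup>+t\<in>{0..h}. ennreal (survival M B U t x * t powr (a - 1)) \<partial>lborel) \<le>
      ennreal K + ennreal (K * a) * (\<integral>\<^sup>+s. \<integral>\<^sup>+\<omega>. ennreal (s powr (a - 1)) *
      of_bool (ennreal (K * s powr a) \<le> G \<omega>) * indicator {1..V x} s \<partial>M \<partial>lborel)" .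
  have "(\<integral>\<^sup>+s. \<integral>\<^sup>+\<omega>. ennreal (s powr (a - 1)) * of_bool (ennreal (K * s powr a) \<le> G \<omega>) *
      indicator {1..V x} s \<partial>M \<partial>lborel) \<le> (\<integral>\<^sup>+s. ennreal C * (ennreal (s powr (a - 1) * gauss_weight V x s) * indicator {1..V x} s) \<partial>lborel)"
  proof (rule nn_integral_mono)
    fix s :: real
    show "(\<integral>\<^sup>+\<omega>. ennreal (s powr (a - 1)) * of_bool (ennreal (K * s powr a) \<le> G \<omega>) * indicator {1..V x} s \<partial>M) \<le>
      ennreal C * (ennreal (s powr (a - 1) * gauss_weight V x s) * indicator {1..V x} s)"
    proof (cases "s \<in> {1..V x}")
      case True
      define A where "A = {\<omega> \<in> space M. ennreal (K * s powr a) \<le> G \<omega>}"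
      have A[measurable]: "A \<in> sets M" unfolding A_def by measurable
      have "prob A \<le> C * gauss_weight V x s"
      proof (rule le_gauss_weightI)
        fix r assume r: "0 \<le> r" "AE y in lebesgue. y \<in> cball x r \<longrightarrow> V x / s \<le> V y"
        obtain E where E: "E \<in> sets M" "emeasure M E \<le> ennreal (C * exp (- r\<^sup>2 / 4))"
          "\<And>\<omega> q. \<omega> \<in> space M \<Longrightarrow> \<omega> \<notin> E \<Longrightarrow> q \<in> {0..h} \<Longrightarrow> norm (B q \<omega>) \<le> r"
          using tail[OF r(1)] by auto
        have "AE y in lborel. y \<in> cball x r \<longrightarrow> V x / s \<le> U y"
          using eq r(2)[unfolded AE_completion_iff] by eventually_elim auto
        then have "AE \<omega> in M. AE q in lborel. 0 \<le> q \<longrightarrow> x + B q \<omega> \<in> cball x r \<longrightarrow> V x / s \<le> U (x + B q \<omega>)"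
          by (rule AE_along_path)
        then have "AE \<omega> in M. \<omega> \<in> A \<longrightarrow> \<omega> \<in> E"
          using AE_space
        proof eventually_elim
          case (elim \<omega>)
          have "G \<omega> < ennreal (K * s powr a)" if "\<omega> \<notin> E"
          proof -
            have ge: "t * (V x / s) \<le> energy U t x (\<lambda>q. B q \<omega>)" if t: "t \<in> {0..h}" for t
            proof (rule energy_ge[OF U continuous_paths[OF elim(2)]])
              show "AE q in lborel. q \<in> {0..t} \<longrightarrow> V x / s \<le> U (x + B q \<omega>)"
                using elim(1)
              proof eventually_elim
                case (elim q)
                then show ?case
                  using E(3)[OF \<open>\<omega> \<in> space M\<close> \<open>\<omega> \<notin> E\<close>, of q] t by (auto simp: dist_norm)
              qed
            qed (use t in auto)
            have le: "exp (- energy U t x (\<lambda>s. B s \<omega>)) * t powr (a - 1) \<le> exp (- (V x / s * t)) * t powr (a - 1)"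
              if "0 \<le> t" "t \<le> h" for t
              using ge[of t] that by (intro mult_right_mono) (simp_all add: mult.commute)
            have "G \<omega> \<le> ennreal (V x powr a) * (\<integral>\<^sup>+t\<in>{0..}. ennreal (exp (- (V x / s * t)) * t powr (a - 1)) \<partial>lborel)"
              unfolding G_def using le by (intro mult_left_mono nn_integral_mono) (auto simp: indicator_def intro!: ennreal_leI)
            also have "\<dots> = ennreal (V x powr a * (Gamma a * (V x / s) powr (- a)))"
            proof -
              have "0 < V x / s" using True V by auto
              then show ?thesis
                unfolding nn_integral_Gamma_scaled[OF a \<open>0 < V x / s\<close>] by (intro ennreal_mult'[symmetric]) simp
            qed
            also have "V x powr a * (Gamma a * (V x / s) powr (- a)) = Gamma a * s powr a"
              using True V by (simp add: powr_minus powr_divide field_simps)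
            also have "ennreal (Gamma a * s powr a) < ennreal (K * s powr a)"
              using K(1) True Gamma_real_pos[OF a] by (intro ennreal_lessI) auto
            finally show ?thesis .
          qed
          then show ?case by (auto simp: A_def not_less[symmetric])
        qed
        then have "emeasure M A \<le> emeasure M E" using E(1) by (intro emeasure_mono_AE)
        from order_trans[OF this E(2)] have "ennreal (prob A) \<le> ennreal (C * exp (- r\<^sup>2 / 4))"
          by (simp only: emeasure_eq_measure)
        then show "prob A \<le> C * exp (- r\<^sup>2 / 4)"
          using C by (subst (asm) ennreal_le_iff) auto
      qed (use True V C in auto)
      then have "emeasure M A \<le> ennreal (C * gauss_weight V x s)"
        by (simp add: emeasure_eq_measure ennreal_leI)
      have "(\<integral>\<^sup>+\<omega>. ennreal (s powr (a - 1)) * of_bool (ennreal (K * s powr a) \<le> G \<omega>) * indicator {1..V x} s \<partial>M) =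
          (\<integral>\<^sup>+\<omega>. ennreal (s powr (a - 1)) * indicator A \<omega> \<partial>M)"
        using True by (intro nn_integral_cong) (auto simp: A_def indicator_def)
      also have "\<dots> = ennreal (s powr (a - 1)) * emeasure M A"
        by (simp add: nn_integral_cmult)
      also have "\<dots> \<le> ennreal (s powr (a - 1)) * ennreal (C * gauss_weight V x s)"
        by (intro mult_left_mono) (fact, simp)
      also have "\<dots> = ennreal C * (ennreal (s powr (a - 1) * gauss_weight V x s) * indicator {1..V x} s)"
        using True C by (simp add: ennreal_mult'[symmetric] gauss_weight_bounds mult_ac)
      finally show ?thesis .
    qed simp
  qed
  also have "\<dots> = ennreal C * ennreal (I_fun a V x)"
  proof -
    have "(\<lambda>s. ennreal (indicator {1..V x} s *\<^sub>R (s powr (a - 1) * gauss_weight V x s))) \<in> borel_measurable lborel"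
      using V by (intro measurable_compose[OF measurable_I_fun_integrand measurable_ennreal]) simp
    also have "(\<lambda>s. ennreal (indicator {1..V x} s *\<^sub>R (s powr (a - 1) * gauss_weight V x s))) =
        (\<lambda>s. ennreal (s powr (a - 1) * gauss_weight V x s) * indicator {1..V x} s)"
      by (auto simp: fun_eq_iff indicator_def)
    finally show ?thesis
      by (subst nn_integral_cmult) (simp_all only: I_fun_eq_nn_integral[of V x a, OF V])
  qed
  finally have "(\<integral>\<^sup>+s. \<integral>\<^sup>+\<omega>. ennreal (s powr (a - 1)) * of_bool (ennreal (K * s powr a) \<le> G \<omega>) *
      indicator {1..V x} s \<partial>M \<partial>lborel) \<le> ennreal C * ennreal (I_fun a V x)" .
  then have "ennreal K + ennreal (K * a) * (\<integral>\<^sup>+s. \<integral>\<^sup>+\<omega>. ennreal (s powr (a - 1)) *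
      of_bool (ennreal (K * s powr a) \<le> G \<omega>) * indicator {1..V x} s \<partial>M \<partial>lborel) \<le>
      ennreal K + ennreal (K * a) * (ennreal C * ennreal (I_fun a V x))"
    by (intro add_left_mono mult_left_mono) auto
  also have "\<dots> = ennreal (K + K * a * (C * I_fun a V x))"
    using K0 a C I_fun_nonneg[of a V x] by (simp add: ennreal_plus ennreal_mult)
  finally show ?thesis using main by (rule order_trans[rotated])
qed

end

section \<open>Boundedness of the Riesz transform\<close>

theorem theorem4p5:
  fixes M :: "'w measure"
    and B :: "real \<Rightarrow> 'w \<Rightarrow> 'a :: euclidean_space"
    and V :: "'a \<Rightarrow> real"
    and \<delta> a C' :: real
    and F :: "'a set"
  assumes "brownian_motion M B"
    and "Linf_loc V"
    and "AE x in lebesgue. 0 \<le> V x"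
    and "\<delta> > 0"
    and "exponential_decay M B V \<delta>"
    and "a > 0"
    and "compact F"
    and "C' > 0"
    and "AE x in lebesgue. x \<notin> F \<longrightarrow> I_fun a V x \<le> C'"
  shows "riesz_bounded M B V a"
proof -
  interpret brownian_motion M B by fact
  note V = \<open>Linf_loc V\<close> \<open>AE x in lebesgue. 0 \<le> V x\<close>
  note \<delta> = \<open>\<delta> > 0\<close> and decay = \<open>exponential_decay M B V \<delta>\<close>
  note a = \<open>a > 0\<close> and F = \<open>compact F\<close>
  note I = \<open>AE x in lebesgue. x \<notin> F \<longrightarrow> I_fun a V x \<le> C'\<close>
  obtain U where U: "locally_bounded_potential U" and eq: "AE x in lborel. V x = U x"
    by (rule locally_bounded_potential_representative[OF V])
  then have [measurable]: "U \<in> borel_measurable borel" by (simp add: locally_bounded_potential_def)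
  \<comment> \<open>The horizon of the maximal inequality.\<close>
  define h :: real where "h = 1 / 16"
  obtain K where K: "1 \<le> K" and tail: "\<And>r. 0 \<le> r \<Longrightarrow> \<exists>E\<in>sets M. emeasure M E \<le> ennreal (K * exp (- r\<^sup>2 / 4)) \<and>
      (\<forall>\<omega>\<in>space M - E. \<forall>q\<in>{0..h}. norm (B q \<omega>) \<le> r)"
    using path_tail unfolding h_def by blast
  obtain D where D: "0 < D"
    "\<And>t. 0 < t \<Longrightarrow> Linf_norm (schrodinger_semigroup M B V t (\<lambda>_. 1)) \<le> ennreal (D * exp (- \<delta> * t))"
    using decay unfolding exponential_decay_def by blast
  have semigroup: "schrodinger_semigroup M B V t (\<lambda>_. 1) x = survival M B U t x" for t x
    by (rule schrodinger_semigroup_eq_survival[OF U eq])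
  have survival_AE: "AE y in lborel. survival M B U t y \<le> D * exp (- (\<delta> * t))" if "0 < t" for t
  proof -
    have "AE y in lebesgue. ennreal \<bar>survival M B U t y\<bar> \<le> Linf_norm (\<lambda>y. survival M B U t y)"
      unfolding Linf_norm_def by (rule esssup_AE)
    moreover have "Linf_norm (\<lambda>y. survival M B U t y) \<le> ennreal (D * exp (- \<delta> * t))"
    proof -
      have "schrodinger_semigroup M B V t (\<lambda>_. 1) = survival M B U t"
        by (rule ext) (rule semigroup)
      then show ?thesis using D(2)[OF that] by simp
    qed
    ultimately have "AE y in lebesgue. survival M B U t y \<le> D * exp (- (\<delta> * t))"
      using D(1) by (auto elim!: eventually_mono dest: order_trans simp: survival_nonneg ennreal_le_iff)
    then show ?thesis by (simp add: AE_completion_iff)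
  qed
  obtain c0 where c0: "AE x in lebesgue. x \<in> F \<longrightarrow> \<bar>V x\<bar> \<le> c0"
    using V(1) F unfolding Linf_loc_def by blast
  define c where "c = max 1 c0"
  define K1 where "K1 = max (Gamma a + 1) (h powr a / a)"
  define L where "L = max (c powr a * (h powr a / a)) (K1 + K1 * a * (K * C'))"
  define L' where "L' = 1 + D * exp (\<delta> * h) * (Gamma a * \<delta> powr (- a)) * (a / h powr a)"
  have K1: "0 \<le> K1" using Gamma_real_pos[OF a] by (simp add: K1_def)
  define J where "J x = (\<integral>\<^sup>+t\<in>{0..h}. ennreal (survival M B U t x * t powr (a - 1)) \<partial>lborel)" for x
  \<comment> \<open>Where \<open>V\<close> is bounded, estimating the survival by \<open>1\<close> is enough; this covers \<open>F\<close> and \<open>V x \<le> 1\<close>.\<close>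
  have small: "ennreal (V x powr a) * J x \<le> ennreal L" if "0 \<le> V x" "V x \<le> c" for x
  proof -
    have "J x \<le> (\<integral>\<^sup>+t\<in>{0..h}. ennreal (t powr (a - 1)) \<partial>lborel)"
      unfolding J_def by (intro nn_integral_mono)
        (auto simp: indicator_def survival_nonneg survival_le_1[OF U] intro!: ennreal_leI mult_left_le_one_le)
    also have "\<dots> = ennreal (h powr a / a)"
      using a by (intro nn_integral_powr_Icc) (simp_all add: h_def)
    finally have "ennreal (V x powr a) * J x \<le> ennreal (c powr a) * ennreal (h powr a / a)"
      using that a by (intro mult_mono ennreal_leI powr_mono2) auto
    also have "\<dots> = ennreal (c powr a * (h powr a / a))"
      by (rule ennreal_mult'[symmetric]) simp
    also have "\<dots> \<le> ennreal L" by (intro ennreal_leI) (simp add: L_def)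
    finally show ?thesis .
  qed
  have large: "ennreal (V x powr a) * J x \<le> ennreal L" if "1 \<le> V x" "I_fun a V x \<le> C'" for x
  proof -
    have "ennreal (V x powr a) * J x \<le> ennreal (K1 + K1 * a * (K * I_fun a V x))"
      unfolding J_def using K
      by (intro survival_integral_local[OF U eq a that(1) _ tail]) (simp_all add: h_def K1_def)
    also have "\<dots> \<le> ennreal (K1 + K1 * a * (K * C'))"
      using K K1 a that by (intro ennreal_leI add_left_mono mult_left_mono) auto
    also have "\<dots> \<le> ennreal L" by (intro ennreal_leI) (simp add: L_def)
    finally show ?thesis .
  qed
  have bound: "riesz_one M B V a x \<le> ennreal (1 / Gamma a) * (ennreal L' * ennreal L)"
    if x: "ennreal (V x powr a) * J x \<le> ennreal L" for x
  proof -
    have "riesz_one M B V a x \<le> ennreal (V x powr a) * (ennreal (1 / Gamma a) * (ennreal L' * J x))"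
      unfolding riesz_one_def semigroup J_def L'_def
      using D(1) by (intro mult_left_mono survival_integral_tail[OF U _ a \<delta> _ survival_AE]) (simp_all add: h_def)
    also have "\<dots> = ennreal (1 / Gamma a) * (ennreal L' * (ennreal (V x powr a) * J x))"
      by (simp add: mult_ac)
    also have "\<dots> \<le> ennreal (1 / Gamma a) * (ennreal L' * ennreal L)"
      by (intro mult_left_mono x) auto
    finally show ?thesis .
  qed
  have "AE x in lebesgue. riesz_one M B V a x \<le> ennreal (1 / Gamma a) * (ennreal L' * ennreal L)"
    using V(2) c0 I
  proof eventually_elim
    case (elim x)
    show ?case
    proof (rule bound, cases "x \<in> F \<or> V x \<le> 1")
      case True
      then show "ennreal (V x powr a) * J x \<le> ennreal L"
        using elim by (intro small) (auto simp: c_def)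
    qed (use elim in \<open>auto intro: large\<close>)
  qed
  \<comment> \<open>The essential supremum of a function that is not measurable would be infinite.\<close>
  moreover have "riesz_one M B V a \<in> borel_measurable lebesgue"
  proof -
    have [measurable]: "V \<in> borel_measurable lebesgue" using V(1) by (simp add: Linf_loc_def)
    have [measurable]: "(\<lambda>w. survival M B U (snd w) (fst w)) \<in> borel_measurable (lborel \<Otimes>\<^sub>M lborel)"
      by (rule measurable_survival) auto
    have "(\<lambda>x. \<integral>\<^sup>+t\<in>{0<..}. ennreal (survival M B U t x * t powr (a - 1)) \<partial>lborel) \<in> borel_measurable lborel"
      by measurable
    from measurable_completion[OF this] show ?thesis
      unfolding riesz_one_def semigroup by measurable
  qed
  ultimately have "esssup lebesgue (riesz_one M B V a) \<le> ennreal (1 / Gamma a) * (ennreal L' * ennreal L)"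
    by (intro esssup_I)
  also have "\<dots> < \<infinity>"
    by (simp add: ennreal_mult_less_top)
  finally show ?thesis unfolding riesz_bounded_def .
qed

end
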